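(* Let $H$ be an associative unital algebra over a field $\Bbbk$, let $\mathscr C$ be a full abelian subcategory of the category of left $H$-modules closed under submodules, equipped with a finite duality functor ${}^\star$. Suppose that all objects in $\mathscr C$ have finite length. Then: (a) if $H^*_{\mathscr C}=\underline{H}^*_{\mathscr C}$ (that is, the natural homomorphism $\underline{H}^*_{\mathscr C}\to H^*_{\mathscr C}$ is an isomorphism), then $\mathscr C$ is semisimple; (b) if $\mathscr C$ is semisimple and $V\otimes_{D(V)}V^\star$ is simple as an $H$-bimodule for every simple object $V$ of $\mathscr C$, then $H^*_{\mathscr C}=\underline{H}^*_{\mathscr C}$ (in the same sense).
   Context: The left (resp. right) action of $H$ on a module is denoted $\triangleright$ (resp. $\triangleleft$). For a left $H$-module $V$, $V^*=\mathrm{Hom}_\Bbbk(V,\Bbbk)$ is a right $H$-module via $\langle v,f\triangleleft h\rangle_V=\langle h\triangleright v,f\rangle_V$, where $\langle\cdot,\cdot\rangle_V:V\otimes V^*\to\Bbbk$ is the evaluation pairing. A finite duality functor is a (contravariant, additive) functor ${}^\star$ from $\mathscr C$ to right $H$-modules, acting on morphisms by transposition, such that $V^\star\subseteq V^*$ is an $H$-submodule, with equality if and only if $V$ is finite dimensional, and such that the restriction of $\langle\cdot,\cdot\rangle_V$ to $V\otimes V^\star$ is non-degenerate for all $V\in\mathscr C$; here $D(V):=\mathrm{End}_H V^\star=(\mathrm{End}_H V)^{op}$, so that $V$ is a right $D(V)$-module and $V^\star$ a left $D(V)$-module. $V\otimes V^\star$ (and its quotient $V\otimes_{D(V)}V^\star$)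 is an $H$-bimodule via $h\triangleright(v\otimes f)\triangleleft h'=(h\triangleright v)\otimes(f\triangleleft h')$, and $H^*=\mathrm{Hom}_\Bbbk(H,\Bbbk)$ is an $H$-bimodule via $(h\triangleright\xi\triangleleft h')(x)=\xi(h'xh)$. For $V\in\mathscr C$ define the $H$-bimodule homomorphism $\beta_V:V\otimes_{D(V)}V^\star\to H^*$ by $\beta_V(v\otimes f)(h)=\langle h\triangleright v,f\rangle_V$, and set $H^*_V=\mathrm{Im}\,\beta_V\subseteq H^*$; it depends only on the isomorphism class $[V]$. Let $\mathrm{Iso}\,\mathscr C$ (resp. $\mathrm{Iso}^\circ\mathscr C$) be the set of isomorphism classes of objects (resp. simple objects) of $\mathscr C$, and set $H^*_{\mathscr C}=\sum_{[V]\in \mathrm{Iso}\,\mathscr C}H^*_V\subseteq H^*$ and $\underline{H}^*_{\mathscr C}=\bigoplus_{[V]\in\mathrm{Iso}^\circ\mathscr C}H^*_V$ (external direct sum). The natural homomorphism $\underline{H}^*_{\mathscr C}\to H^*_{\mathscr C}$ is induced by the inclusions $H^*_V\subseteq H^*_{\mathscr C}$. *)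

theory Defs
  imports Complex_Main "HOL-Algebra.Free_Abelian_Groups"
begin

section \<open>Algebras and modules\<close>

text \<open>
  The field and the algebra \<open>H\<close> are types.  The sort \<open>{ring, monoid_mult}\<close> is that of unital
  associative rings in which \<open>0 = 1\<close> is not excluded, unlike in \<^class>\<open>ring_1\<close>.
\<close>

locale assoc_algebra = vector_space scale
  for scale :: "'k::field \<Rightarrow> 'h::{ring, monoid_mult} \<Rightarrow> 'h" +
  assumes scale_mult_left: "scale a x * y = scale a (x * y)"
    and scale_mult_right: "x * scale a y = scale a (x * y)"

text \<open>
  Modules live on carrier sets.  Their additive groups are \<^locale>\<open>comm_group\<close>s, hence written
  with \<open>\<otimes>\<close> and \<open>\<one>\<close> although they are thought of as \<open>+\<close> and \<open>0\<close>.
\<close>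

record ('h, 'm) lmodule = "'m monoid" +
  lact :: "'h \<Rightarrow> 'm \<Rightarrow> 'm"  (infixr "\<triangleright>\<index>" 75)

record ('h, 'm) rmodule = "'m monoid" +
  ract :: "'m \<Rightarrow> 'h \<Rightarrow> 'm"  (infixl "\<triangleleft>\<index>" 75)

record ('h, 'm) bimodule = "('h, 'm) lmodule" +
  bract :: "'m \<Rightarrow> 'h \<Rightarrow> 'm"

definition lmodule_of :: "'m monoid \<Rightarrow> ('h \<Rightarrow> 'm \<Rightarrow> 'm) \<Rightarrow> ('h, 'm) lmodule"
  where "lmodule_of G l = \<lparr>carrier = carrier G, monoid.mult = monoid.mult G, one = one G, lact = l\<rparr>"

definition bimodule_of ::
    "'m monoid \<Rightarrow> ('h \<Rightarrow> 'm \<Rightarrow> 'm) \<Rightarrow> ('m \<Rightarrow> 'h \<Rightarrow> 'm) \<Rightarrow> ('h, 'm) bimodule"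
  where "bimodule_of G l r =
    \<lparr>carrier = carrier G, monoid.mult = monoid.mult G, one = one G, lact = l, bract = r\<rparr>"

locale left_module = comm_group V
  for V :: "('h::{ring, monoid_mult}, 'm, 'z) lmodule_scheme" (structure) +
  assumes lact_closed: "v \<in> carrier V \<Longrightarrow> h \<triangleright> v \<in> carrier V"
    and lact_add_right: "\<lbrakk>v \<in> carrier V; w \<in> carrier V\<rbrakk> \<Longrightarrow> h \<triangleright> (v \<otimes> w) = (h \<triangleright> v) \<otimes> (h \<triangleright> w)"
    and lact_add_left: "v \<in> carrier V \<Longrightarrow> (h + h') \<triangleright> v = (h \<triangleright> v) \<otimes> (h' \<triangleright> v)"
    and lact_mult: "v \<in> carrier V \<Longrightarrow> (h * h') \<triangleright> v = h \<triangleright> (h' \<triangleright> v)"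
    and lact_one: "v \<in> carrier V \<Longrightarrow> 1 \<triangleright> v = v"

definition lhom :: "('h, 'm, 'y) lmodule_scheme \<Rightarrow> ('h, 'n, 'z) lmodule_scheme \<Rightarrow> ('m \<Rightarrow> 'n) set"
  where "lhom V W = {\<phi> \<in> hom V W. \<forall>h. \<forall>v\<in>carrier V. \<phi> (h \<triangleright>\<^bsub>V\<^esub> v) = h \<triangleright>\<^bsub>W\<^esub> \<phi> v}"

definition lisomorphic :: "('h, 'm, 'y) lmodule_scheme \<Rightarrow> ('h, 'n, 'z) lmodule_scheme \<Rightarrow> bool"
  where "lisomorphic V W \<longleftrightarrow> (\<exists>\<phi>\<in>lhom V W. bij_betw \<phi> (carrier V) (carrier W))"

definition lsubmodule :: "'m set \<Rightarrow> ('h, 'm, 'z) lmodule_scheme \<Rightarrow> bool"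
  where "lsubmodule U V \<longleftrightarrow> subgroup U V \<and> (\<forall>h. \<forall>u\<in>U. h \<triangleright>\<^bsub>V\<^esub> u \<in> U)"

definition rsubmodule :: "'m set \<Rightarrow> ('h, 'm, 'z) rmodule_scheme \<Rightarrow> bool"
  where "rsubmodule U V \<longleftrightarrow> subgroup U V \<and> (\<forall>h. \<forall>u\<in>U. u \<triangleleft>\<^bsub>V\<^esub> h \<in> U)"

definition simple_lmodule :: "('h, 'm, 'z) lmodule_scheme \<Rightarrow> bool"
  where "simple_lmodule V \<longleftrightarrow> carrier V \<noteq> {\<one>\<^bsub>V\<^esub>} \<and>
           (\<forall>U. lsubmodule U V \<longrightarrow> U = {\<one>\<^bsub>V\<^esub>} \<or> U = carrier V)"

text \<open>
  In a quotient, \<open>h \<triangleright> X\<close> is the coset of \<open>h \<triangleright> v\<close> for any \<open>v \<in> X\<close>; this is a union of equal sets.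
\<close>

definition lquotient :: "('h, 'm) lmodule \<Rightarrow> 'm set \<Rightarrow> ('h, 'm set) lmodule"
  where "lquotient V U = lmodule_of (V Mod U) (\<lambda>h X. \<Union>v\<in>X. U #>\<^bsub>V\<^esub> (h \<triangleright>\<^bsub>V\<^esub> v))"

definition ldirect_sum :: "'i set \<Rightarrow> ('i \<Rightarrow> ('h, 'm) lmodule) \<Rightarrow> ('h, 'i \<Rightarrow> 'm) lmodule"
  where "ldirect_sum I M = lmodule_of (sum_group I M) (\<lambda>h x. \<lambda>i\<in>I. h \<triangleright>\<^bsub>M i\<^esub> x i)"

text \<open>Finite length: there is a composition series
  \<open>0 = U\<^sub>0 \<subseteq> U\<^sub>1 \<subseteq> \<dots> \<subseteq> U\<^sub>n = V\<close>.\<close>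

definition finite_length :: "('h, 'm) lmodule \<Rightarrow> bool"
  where "finite_length V \<longleftrightarrow> (\<exists>(n::nat) U.
           U 0 = {\<one>\<^bsub>V\<^esub>} \<and> U n = carrier V \<and> (\<forall>i\<le>n. lsubmodule (U i) V) \<and>
           (\<forall>i<n. U i \<subseteq> U (Suc i) \<and> simple_lmodule (lquotient (V\<lparr>carrier := U (Suc i)\<rparr>) (U i))))"


section \<open>Categories of modules\<close>

text \<open>
  A full subcategory is given by its set of objects.  It is not required to be closed under
  isomorphism, so direct sums, kernels and cokernels are only required to be present up to
  isomorphism.  The empty direct sum provides a zero object.
\<close>

definition full_abelian_subcategory :: "('h::{ring, monoid_mult}, 'v) lmodule set \<Rightarrow> bool"
  where "full_abelian_subcategory C \<longleftrightarrow>
     (\<forall>V\<in>C. left_module V) \<and>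
     (\<forall>(n::nat) M. (\<forall>i<n. M i \<in> C) \<longrightarrow> (\<exists>U\<in>C. lisomorphic U (ldirect_sum {..<n} M))) \<and>
     (\<forall>V\<in>C. \<forall>W\<in>C. \<forall>\<phi>\<in>lhom V W.
        (\<exists>U\<in>C. lisomorphic U (V\<lparr>carrier := kernel V W \<phi>\<rparr>)) \<and>
        (\<exists>U\<in>C. lisomorphic U (lquotient W (\<phi> ` carrier V))))"

definition closed_under_submodules :: "('h, 'v) lmodule set \<Rightarrow> bool"
  where "closed_under_submodules C \<longleftrightarrow>
     (\<forall>V\<in>C. \<forall>U. lsubmodule U V \<longrightarrow> V\<lparr>carrier := U\<rparr> \<in> C)"

text \<open>When \<open>C\<close> is closed under submodules, its simple objects are its simple modules.\<close>

definition simple_objects :: "('h, 'v) lmodule set \<Rightarrow> ('h, 'v) lmodule set"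
  where "simple_objects C = {V \<in> C. simple_lmodule V}"

definition semisimple_category :: "('h, 'v) lmodule set \<Rightarrow> bool"
  where "semisimple_category C \<longleftrightarrow>
     (\<forall>V\<in>C. \<exists>(n::nat) M. (\<forall>i<n. M i \<in> simple_objects C) \<and> lisomorphic V (ldirect_sum {..<n} M))"

definition iso_rel :: "('h, 'v) lmodule set \<Rightarrow> ('h, 'v) lmodule rel"
  where "iso_rel C = {(V, W). V \<in> C \<and> W \<in> C \<and> lisomorphic V W}"

definition Iso :: "('h, 'v) lmodule set \<Rightarrow> ('h, 'v) lmodule set set"
  where "Iso C = C // iso_rel C"

definition Iso_simple :: "('h, 'v) lmodule set \<Rightarrow> ('h, 'v) lmodule set set"
  where "Iso_simple C = simple_objects C // iso_rel C"


section \<open>Duals and finite duality functors\<close>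

text \<open>
  The field acts on a left \<open>H\<close>-module by \<open>a v = (a 1) \<triangleright> v\<close>.  Linear functionals on \<open>V\<close> are
  represented by functions that are \<^const>\<open>undefined\<close> outside the carrier, and
  \<open>f v\<close> is the evaluation pairing of \<open>v\<close> and \<open>f\<close>.
\<close>

definition dual :: "('k::field \<Rightarrow> 'h::{ring, monoid_mult} \<Rightarrow> 'h) \<Rightarrow> ('h, 'v) lmodule
    \<Rightarrow> ('h, 'v \<Rightarrow> 'k) rmodule"
  where "dual scale V =
    \<lparr>carrier = {f \<in> extensional (carrier V).
        (\<forall>v\<in>carrier V. \<forall>w\<in>carrier V. f (v \<otimes>\<^bsub>V\<^esub> w) = f v + f w) \<and>
        (\<forall>a. \<forall>v\<in>carrier V. f (scale a 1 \<triangleright>\<^bsub>V\<^esub> v) = a * f v)},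
     monoid.mult = (\<lambda>f g. \<lambda>v\<in>carrier V. f v + g v),
     one = (\<lambda>v\<in>carrier V. 0),
     ract = (\<lambda>f h. \<lambda>v\<in>carrier V. f (h \<triangleright>\<^bsub>V\<^esub> v))\<rparr>"

definition finite_dim :: "('k::field \<Rightarrow> 'h::{ring, monoid_mult} \<Rightarrow> 'h) \<Rightarrow> ('h, 'v) lmodule \<Rightarrow> bool"
  where "finite_dim scale V \<longleftrightarrow> (\<exists>B. finite B \<and> B \<subseteq> carrier V \<and>
     (\<forall>v\<in>carrier V. \<exists>c. v = finprod V (\<lambda>b. scale (c b) 1 \<triangleright>\<^bsub>V\<^esub> b) B))"

text \<open>
  \<open>St V\<close> is the underlying set of \<open>V\<^sup>\<star>\<close>, whose structure is inherited from the full dual.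
  The functor acts on a morphism \<open>\<phi> : V \<rightarrow> W\<close> by its transpose \<open>f \<mapsto> f \<circ> \<phi>\<close>, so that
  functoriality amounts to transposes mapping \<open>W\<^sup>\<star>\<close> into \<open>V\<^sup>\<star>\<close>; contravariance, additivity and
  \<open>H\<close>-linearity are automatic.
\<close>

definition finite_duality_functor ::
    "('k::field \<Rightarrow> 'h::{ring, monoid_mult} \<Rightarrow> 'h) \<Rightarrow> ('h, 'v) lmodule set
      \<Rightarrow> (('h, 'v) lmodule \<Rightarrow> ('v \<Rightarrow> 'k) set) \<Rightarrow> bool"
  where "finite_duality_functor scale C St \<longleftrightarrow>
    (\<forall>V\<in>C. rsubmodule (St V) (dual scale V)) \<and>
    (\<forall>V\<in>C. \<forall>W\<in>C. \<forall>\<phi>\<in>lhom V W. \<forall>f\<in>St W. compose (carrier V) f \<phi> \<in> St V) \<and>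
    (\<forall>V\<in>C. St V = carrier (dual scale V) \<longleftrightarrow> finite_dim scale V) \<and>
    (\<forall>V\<in>C. (\<forall>v\<in>carrier V. (\<forall>f\<in>St V. f v = 0) \<longrightarrow> v = \<one>\<^bsub>V\<^esub>) \<and>
           (\<forall>f\<in>St V. (\<forall>v\<in>carrier V. f v = 0) \<longrightarrow> f = \<one>\<^bsub>dual scale V\<^esub>))"


section \<open>Bimodules\<close>

definition subbimodule :: "'m set \<Rightarrow> ('h, 'm, 'z) bimodule_scheme \<Rightarrow> bool"
  where "subbimodule U M \<longleftrightarrow> lsubmodule U M \<and> (\<forall>h. \<forall>u\<in>U. bract M u h \<in> U)"

definition simple_bimodule :: "('h, 'm, 'z) bimodule_scheme \<Rightarrow> bool"
  where "simple_bimodule M \<longleftrightarrow> carrier M \<noteq> {\<one>\<^bsub>M\<^esub>} \<and>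
           (\<forall>U. subbimodule U M \<longrightarrow> U = {\<one>\<^bsub>M\<^esub>} \<or> U = carrier M)"

definition bimodule_iso :: "('h, 'm) bimodule \<Rightarrow> ('h, 'n) bimodule \<Rightarrow> ('m \<Rightarrow> 'n) set"
  where "bimodule_iso M N = {\<phi> \<in> lhom M N.
           (\<forall>h. \<forall>x\<in>carrier M. \<phi> (bract M x h) = bract N (\<phi> x) h) \<and>
           bij_betw \<phi> (carrier M) (carrier N)}"

definition bdirect_sum :: "'i set \<Rightarrow> ('i \<Rightarrow> ('h, 'm) bimodule) \<Rightarrow> ('h, 'i \<Rightarrow> 'm) bimodule"
  where "bdirect_sum I M = bimodule_of (sum_group I M)
           (\<lambda>h x. \<lambda>i\<in>I. h \<triangleright>\<^bsub>M i\<^esub> x i) (\<lambda>x h. \<lambda>i\<in>I. bract (M i) (x i) h)"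

text \<open>\<open>H\<^sup>*\<close> with the actions \<open>(h \<triangleright> \<xi> \<triangleleft> h')(x) = \<xi> (h' x h)\<close>.\<close>

definition Hdual :: "('k::field \<Rightarrow> 'h::{ring, monoid_mult} \<Rightarrow> 'h) \<Rightarrow> ('h, 'h \<Rightarrow> 'k) bimodule"
  where "Hdual scale =
    \<lparr>carrier = {\<xi>. Vector_Spaces.linear scale (*) \<xi>},
     monoid.mult = (\<lambda>\<xi> \<zeta> x. \<xi> x + \<zeta> x),
     one = (\<lambda>x. 0),
     lact = (\<lambda>h \<xi> x. \<xi> (x * h)),
     bract = (\<lambda>\<xi> h' x. \<xi> (h' * x))\<rparr>"

text \<open>
  \<open>V \<otimes> V\<^sup>\<star>\<close> over \<open>D(V) = (End\<^sub>H V)\<^sup>o\<^sup>p\<close>: the free abelian group on \<open>V \<times> V\<^sup>\<star>\<close> modulo biadditivity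
  and \<open>(v \<triangleleft> d) \<otimes> f = v \<otimes> (d \<triangleright> f)\<close>.  Here \<open>d \<in> End\<^sub>H V\<close> acts on \<open>V\<close> by \<open>v \<triangleleft> d = d v\<close> and on
  \<open>V\<^sup>\<star>\<close> by transposition, \<open>d \<triangleright> f = f \<circ> d\<close>.  Scalars belong to \<open>D(V)\<close>, so this is also
  a quotient of the tensor product over the field.
\<close>

definition tensor_free :: "('h, 'v) lmodule \<Rightarrow> ('v \<Rightarrow> 'k) set \<Rightarrow> ('v \<times> ('v \<Rightarrow> 'k) \<Rightarrow>\<^sub>0 int) monoid"
  where "tensor_free V S = free_Abelian_group (carrier V \<times> S)"

definition tensor_relations ::
    "('k::field \<Rightarrow> 'h::{ring, monoid_mult} \<Rightarrow> 'h) \<Rightarrow> ('h, 'v) lmodule \<Rightarrow> ('v \<Rightarrow> 'k) set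
      \<Rightarrow> ('v \<times> ('v \<Rightarrow> 'k) \<Rightarrow>\<^sub>0 int) set"
  where "tensor_relations scale V S = generate (tensor_free V S)
    ({frag_of (v \<otimes>\<^bsub>V\<^esub> w, f) - frag_of (v, f) - frag_of (w, f) | v w f.
        v \<in> carrier V \<and> w \<in> carrier V \<and> f \<in> S} \<union>
     {frag_of (v, f \<otimes>\<^bsub>dual scale V\<^esub> g) - frag_of (v, f) - frag_of (v, g) | v f g.
        v \<in> carrier V \<and> f \<in> S \<and> g \<in> S} \<union>
     {frag_of (d v, f) - frag_of (v, compose (carrier V) f d) | v f d.
        v \<in> carrier V \<and> f \<in> S \<and> d \<in> lhom V V})"

definition tensor ::
    "('k::field \<Rightarrow> 'h::{ring, monoid_mult} \<Rightarrow> 'h) \<Rightarrow> ('h, 'v) lmodule \<Rightarrow> ('v \<Rightarrow> 'k) set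
      \<Rightarrow> ('h, ('v \<times> ('v \<Rightarrow> 'k) \<Rightarrow>\<^sub>0 int) set) bimodule"
  where "tensor scale V S =
    (let F = tensor_free V S; R = tensor_relations scale V S in
     bimodule_of (F Mod R)
       (\<lambda>h X. \<Union>p\<in>X. R #>\<^bsub>F\<^esub> frag_extend (\<lambda>(v, f). frag_of (h \<triangleright>\<^bsub>V\<^esub> v, f)) p)
       (\<lambda>X h. \<Union>p\<in>X. R #>\<^bsub>F\<^esub> frag_extend (\<lambda>(v, f). frag_of (v, f \<triangleleft>\<^bsub>dual scale V\<^esub> h)) p))"


section \<open>Matrix coefficients\<close>

text \<open>\<open>\<beta>\<^sub>V (v \<otimes> f) h = f (h \<triangleright> v)\<close>, extended additively to the free abelian group and then, as it
  is constant on cosets, to the tensor product.\<close>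

definition beta_free :: "('h, 'v) lmodule \<Rightarrow> ('v \<times> ('v \<Rightarrow> 'k::field) \<Rightarrow>\<^sub>0 int) \<Rightarrow> 'h \<Rightarrow> 'k"
  where "beta_free V p h =
    (\<Sum>(v, f)\<in>Poly_Mapping.keys p. of_int (Poly_Mapping.lookup p (v, f)) * f (h \<triangleright>\<^bsub>V\<^esub> v))"

definition beta :: "('h, 'v) lmodule \<Rightarrow> ('v \<times> ('v \<Rightarrow> 'k::field) \<Rightarrow>\<^sub>0 int) set \<Rightarrow> 'h \<Rightarrow> 'k"
  where "beta V X = the_elem (beta_free V ` X)"

definition Hdual_obj :: "('k::field \<Rightarrow> 'h::{ring, monoid_mult} \<Rightarrow> 'h)
    \<Rightarrow> (('h, 'v) lmodule \<Rightarrow> ('v \<Rightarrow> 'k) set) \<Rightarrow> ('h, 'v) lmodule \<Rightarrow> ('h \<Rightarrow> 'k) set"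
  where "Hdual_obj scale St V = beta V ` carrier (tensor scale V (St V))"

text \<open>\<^const>\<open>Hdual_obj\<close> is invariant under isomorphism, so any representative may be used.\<close>

definition Hdual_class :: "('k::field \<Rightarrow> 'h::{ring, monoid_mult} \<Rightarrow> 'h)
    \<Rightarrow> (('h, 'v) lmodule \<Rightarrow> ('v \<Rightarrow> 'k) set) \<Rightarrow> ('h, 'v) lmodule set \<Rightarrow> ('h \<Rightarrow> 'k) set"
  where "Hdual_class scale St X = Hdual_obj scale St (SOME V. V \<in> X)"

definition Hdual_sum :: "('k::field \<Rightarrow> 'h::{ring, monoid_mult} \<Rightarrow> 'h) \<Rightarrow> ('h, 'v) lmodule set
    \<Rightarrow> (('h, 'v) lmodule \<Rightarrow> ('v \<Rightarrow> 'k) set) \<Rightarrow> ('h, 'h \<Rightarrow> 'k) bimodule"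
  where "Hdual_sum scale C St = Hdual scale
    \<lparr>carrier := {finprod (Hdual scale) \<xi> F | \<xi> F.
        finite F \<and> F \<subseteq> Iso C \<and> (\<forall>X\<in>F. \<xi> X \<in> Hdual_class scale St X)}\<rparr>"

definition Hdual_simple_sum :: "('k::field \<Rightarrow> 'h::{ring, monoid_mult} \<Rightarrow> 'h) \<Rightarrow> ('h, 'v) lmodule set
    \<Rightarrow> (('h, 'v) lmodule \<Rightarrow> ('v \<Rightarrow> 'k) set) \<Rightarrow> ('h, ('h, 'v) lmodule set \<Rightarrow> 'h \<Rightarrow> 'k) bimodule"
  where "Hdual_simple_sum scale C St = bdirect_sum (Iso_simple C)
    (\<lambda>X. Hdual scale \<lparr>carrier := Hdual_class scale St X\<rparr>)"

text \<open>The map \<open>(\<xi>\<^sub>X)\<^sub>X \<mapsto> \<Sum>\<^sub>X \<xi>\<^sub>X\<close>, a sum with finitely many nonzero terms.\<close>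

definition natural_map :: "('k::field \<Rightarrow> 'h::{ring, monoid_mult} \<Rightarrow> 'h) \<Rightarrow> ('h, 'v) lmodule set
    \<Rightarrow> (('h, 'v) lmodule set \<Rightarrow> 'h \<Rightarrow> 'k) \<Rightarrow> 'h \<Rightarrow> 'k"
  where "natural_map scale C \<xi> = gfinprod (Hdual scale) \<xi> (Iso_simple C)"

end

(*
  Part (a). For a functional f in the dual of V, the map sending v to the matrix coefficient of
  v and f is a homomorphism of left modules from V to the full dual of H.  If every coefficient is a
  sum of coefficients of simple objects, its image lies in the socle.  If f does not vanish on a
  simple submodule S of V, the map is injective on S, and pulling back a complement of the image of S
  in the socle splits S off; finite length then gives semisimplicity.

  Part (b). Surjectivity is read off from a decomposition into simple objects.  For injectivity, a
  weak form of the density theorem gives an element of H that acts as the identity on finitely many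
  vectors of one simple module and kills finitely many vectors of simple modules not isomorphic to it;
  translating a relation between coefficients by it isolates a single component.
*)
theory Submission
  imports Defs
begin


section \<open>Modules on carrier sets\<close>

text \<open>Both parts turn on one inclusion,
  \<open>coeffs St C \<subseteq> coeffs St (simple_objects C)\<close>. Surjectivity of the natural
  map yields it and follows from it. The dual of \<open>H\<close> is a single module into which
  every object can be mapped, but it need be neither semisimple nor of finite length. Hence a
  complement inside it comes from Zorn's lemma and covers only the submodules without proper nonzero
  submodules. The map given by one functional may be far from injective on \<open>V\<close>. Since
  simple submodules are split off one at a time, injectivity on \<open>S\<close> is enough, and the
  kernel becomes part of the complement. Finite length enters through chains of submodules of a
  fixed \<open>V\<close>, with simplicity of a quotient read as a covering relation, so that passing
  to a complement is an application of the modular law. Asking the density argument only for the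
  identity on the chosen vectors keeps it valid for linearly dependent ones.\<close>

context left_module
begin

lemma lact_zero_left: "v \<in> carrier V \<Longrightarrow> 0 \<triangleright> v = \<one>"
  using lact_add_left[of v 0 0] lact_closed[of v 0] r_cancel_one'[of "0 \<triangleright> v" "0 \<triangleright> v"] by simp

lemma lact_unit [simp]: "h \<triangleright> \<one> = \<one>"
  using lact_add_right[of \<one> \<one> h] lact_closed[of \<one> h] r_cancel_one'[of "h \<triangleright> \<one>" "h \<triangleright> \<one>"]
  by simp

lemma lact_uminus_one: assumes "v \<in> carrier V" shows "(- 1) \<triangleright> v = inv v"
proof -
  have "v \<otimes> ((- 1) \<triangleright> v) = \<one>"
    using lact_add_left[of v 1 "- 1"] assms by (simp add: lact_one lact_zero_left)
  then show ?thesis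
    using assms inv_equality[of "(- 1) \<triangleright> v" v] m_comm[of v "(- 1) \<triangleright> v"] by (simp add: lact_closed)
qed

lemma lact_uminus: assumes "v \<in> carrier V" shows "(- h) \<triangleright> v = inv (h \<triangleright> v)"
proof -
  have "h \<triangleright> v \<otimes> ((- h) \<triangleright> v) = \<one>"
    using lact_add_left[of v h "- h"] assms by (simp add: lact_zero_left)
  then show ?thesis
    using assms inv_equality[of "(- h) \<triangleright> v" "h \<triangleright> v"] m_comm[of "h \<triangleright> v" "(- h) \<triangleright> v"]
    by (simp add: lact_closed)
qed

lemma lact_diff_eq:
  assumes "v \<in> carrier V" "h \<triangleright> v = h' \<triangleright> v" shows "(h - h') \<triangleright> v = \<one>"
  using lact_add_left[of v h "- h'"] assms by (simp add: lact_uminus lact_closed)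

text \<open>Closure under inverses comes for free, since -1 acts as inversion.\<close>

lemma lsubmoduleI:
  assumes "U \<subseteq> carrier V" "\<one> \<in> U" "\<And>u w. u \<in> U \<Longrightarrow> w \<in> U \<Longrightarrow> u \<otimes> w \<in> U"
    and "\<And>h u. u \<in> U \<Longrightarrow> h \<triangleright> u \<in> U"
  shows "lsubmodule U V"
proof -
  have "inv u \<in> U" if "u \<in> U" for u
    using that assms(1) assms(4)[OF that, of "- 1"] lact_uminus_one[of u] by auto
  then show ?thesis
    using assms unfolding lsubmodule_def by (auto intro!: subgroup.intro)
qed

lemma lsubmodule_carrier: "lsubmodule (carrier V) V"
  by (intro lsubmoduleI) (auto intro: lact_closed)

lemma lsubmodule_trivial: "lsubmodule {\<one>} V"
  by (intro lsubmoduleI) auto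

end

lemma lsubmoduleD:
  assumes "lsubmodule U V"
  shows "subgroup U V" "U \<subseteq> carrier V" "\<one>\<^bsub>V\<^esub> \<in> U"
    "\<And>u w. u \<in> U \<Longrightarrow> w \<in> U \<Longrightarrow> u \<otimes>\<^bsub>V\<^esub> w \<in> U"
    "\<And>u. u \<in> U \<Longrightarrow> inv\<^bsub>V\<^esub> u \<in> U" "\<And>h u. u \<in> U \<Longrightarrow> h \<triangleright>\<^bsub>V\<^esub> u \<in> U"
  using assms by (auto simp: lsubmodule_def subgroup_def)

context left_module
begin

lemma lsubmodule_Int:
  assumes "lsubmodule U V" "lsubmodule W V" shows "lsubmodule (U \<inter> W) V"
proof (rule lsubmoduleI)
  show "U \<inter> W \<subseteq> carrier V" using lsubmoduleD(2)[OF assms(1)] by blast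
qed (simp_all add: lsubmoduleD(3,4,6)[OF assms(1)] lsubmoduleD(3,4,6)[OF assms(2)])

lemma set_multI: "u \<in> U \<Longrightarrow> w \<in> W \<Longrightarrow> u \<otimes> w \<in> U <#> W"
  by (auto simp: set_mult_def)

lemma set_multE:
  assumes "x \<in> U <#> W" obtains u w where "u \<in> U" "w \<in> W" "x = u \<otimes> w"
  using assms by (auto simp: set_mult_def)

lemma lsubmodule_set_mult:
  assumes "lsubmodule U V" "lsubmodule W V" shows "lsubmodule (U <#> W) V"
proof -
  note U = lsubmoduleD[OF assms(1)] and W = lsubmoduleD[OF assms(2)]
  have "h \<triangleright> x \<in> U <#> W" if "x \<in> U <#> W" for h x
  proof -
    obtain u w where uw: "u \<in> U" "w \<in> W" "x = u \<otimes> w"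
      using \<open>x \<in> U <#> W\<close> by (rule set_multE)
    then have "h \<triangleright> x = h \<triangleright> u \<otimes> h \<triangleright> w"
      using lact_add_right[of u w h] U(2) W(2) by blast
    then show ?thesis
      using set_multI[OF U(6)[OF uw(1), of h] W(6)[OF uw(2), of h]] by simp
  qed
  then show ?thesis
    using mult_subgroups[OF U(1) W(1)] by (simp add: lsubmodule_def)
qed

lemma set_mult_upper:
  assumes "lsubmodule U V" "lsubmodule W V"
  shows "U \<subseteq> U <#> W" "W \<subseteq> U <#> W"
proof -
  note U = lsubmoduleD[OF assms(1)] and W = lsubmoduleD[OF assms(2)]
  show "U \<subseteq> U <#> W"
  proof
    fix x assume x: "x \<in> U"
    then have "x \<in> carrier V" using U(2) by blast
    then show "x \<in> U <#> W" using set_multI[OF x W(3)] by simp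
  qed
  show "W \<subseteq> U <#> W"
  proof
    fix x assume x: "x \<in> W"
    then have "x \<in> carrier V" using W(2) by blast
    then show "x \<in> U <#> W" using set_multI[OF U(3) x] by simp
  qed
qed

lemma set_mult_least:
  assumes "lsubmodule X V" "U \<subseteq> X" "W \<subseteq> X" shows "U <#> W \<subseteq> X"
  using lsubmoduleD(4)[OF assms(1)] assms(2,3) unfolding set_mult_def by blast

lemma left_module_restrict:
  assumes "lsubmodule U V" shows "left_module (V\<lparr>carrier := U\<rparr>)"
proof -
  note U = lsubmoduleD[OF assms]
  interpret G: comm_group "V\<lparr>carrier := U\<rparr>"
    by (intro group.group_comm_groupI subgroup_imp_group U(1)) (use U(2) m_comm in auto)
  show ?thesis
    using U by unfold_locales
      (auto simp: subset_iff lact_add_left lact_add_right lact_mult lact_one)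
qed

text \<open>Submodules of \<open>U\<close> are thereby handled inside the lattice of submodules of
  \<open>V\<close>, which is how simplicity of \<open>U\<close> is used later.\<close>

lemma lsubmodule_restrict_iff:
  assumes "lsubmodule U V"
  shows "lsubmodule X (V\<lparr>carrier := U\<rparr>) \<longleftrightarrow> lsubmodule X V \<and> X \<subseteq> U"
proof
  interpret R: left_module "V\<lparr>carrier := U\<rparr>" by (rule left_module_restrict[OF assms])
  note U = lsubmoduleD[OF assms]
  show "lsubmodule X V \<and> X \<subseteq> U" if "lsubmodule X (V\<lparr>carrier := U\<rparr>)"
    using lsubmoduleD[OF that] U by (auto intro!: lsubmoduleI)
  show "lsubmodule X (V\<lparr>carrier := U\<rparr>)" if "lsubmodule X V \<and> X \<subseteq> U"
    using that lsubmoduleD[of X V] by (intro R.lsubmoduleI) auto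
qed

end


section \<open>Homomorphisms\<close>

lemma lhomI:
  assumes "\<And>v. v \<in> carrier V \<Longrightarrow> \<phi> v \<in> carrier W"
    and "\<And>v w. v \<in> carrier V \<Longrightarrow> w \<in> carrier V \<Longrightarrow> \<phi> (v \<otimes>\<^bsub>V\<^esub> w) = \<phi> v \<otimes>\<^bsub>W\<^esub> \<phi> w"
    and "\<And>h v. v \<in> carrier V \<Longrightarrow> \<phi> (h \<triangleright>\<^bsub>V\<^esub> v) = h \<triangleright>\<^bsub>W\<^esub> \<phi> v"
  shows "\<phi> \<in> lhom V W"
  using assms by (auto simp: lhom_def hom_def)

lemma lhomD:
  assumes "\<phi> \<in> lhom V W"
  shows "\<And>v. v \<in> carrier V \<Longrightarrow> \<phi> v \<in> carrier W"
    and "\<And>v w. v \<in> carrier V \<Longrightarrow> w \<in> carrier V \<Longrightarrow> \<phi> (v \<otimes>\<^bsub>V\<^esub> w) = \<phi> v \<otimes>\<^bsub>W\<^esub> \<phi> w"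
    and "\<And>h v. v \<in> carrier V \<Longrightarrow> \<phi> (h \<triangleright>\<^bsub>V\<^esub> v) = h \<triangleright>\<^bsub>W\<^esub> \<phi> v"
  using assms by (auto simp: lhom_def hom_def)

lemma lhom_comp: "\<phi> \<in> lhom V W \<Longrightarrow> \<psi> \<in> lhom W X \<Longrightarrow> \<psi> \<circ> \<phi> \<in> lhom V X"
  by (intro lhomI) (auto simp: lhomD)

lemma inv_into_lhom:
  assumes "left_module V" and \<phi>: "\<phi> \<in> lhom V W" and bij: "bij_betw \<phi> (carrier V) (carrier W)"
  shows "inv_into (carrier V) \<phi> \<in> lhom W V"
proof -
  interpret left_module V by fact
  note map = lhomD[OF \<phi>]
  let ?\<psi> = "inv_into (carrier V) \<phi>"
  have in_V: "?\<psi> w \<in> carrier V" and right: "\<phi> (?\<psi> w) = w" if "w \<in> carrier W" for w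
    using that bij by (auto simp: bij_betw_def inv_into_into f_inv_into_f)
  have left: "?\<psi> (\<phi> v) = v" if "v \<in> carrier V" for v
    using that bij by (auto simp: bij_betw_def)
  show ?thesis
  proof (rule lhomI)
    show "?\<psi> (v \<otimes>\<^bsub>W\<^esub> w) = ?\<psi> v \<otimes>\<^bsub>V\<^esub> ?\<psi> w" if "v \<in> carrier W" "w \<in> carrier W" for v w
      using that in_V right left[of "?\<psi> v \<otimes>\<^bsub>V\<^esub> ?\<psi> w"] by (simp add: map)
    show "?\<psi> (h \<triangleright>\<^bsub>W\<^esub> v) = h \<triangleright>\<^bsub>V\<^esub> ?\<psi> v" if "v \<in> carrier W" for v h
      using that in_V right left[of "h \<triangleright>\<^bsub>V\<^esub> ?\<psi> v"] by (simp add: map lact_closed)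
  qed (rule in_V)
qed

locale lmodule_hom = V: left_module V + W: left_module W
  for V :: "('h::{ring, monoid_mult}, 'm, 'y) lmodule_scheme"
    and W :: "('h, 'n, 'z) lmodule_scheme" and \<phi> +
  assumes lhom: "\<phi> \<in> lhom V W"
begin

lemmas map = lhomD[OF lhom]

lemma map_one [simp]: "\<phi> \<one>\<^bsub>V\<^esub> = \<one>\<^bsub>W\<^esub>"
  using lhom hom_one[of \<phi> V W] V.is_group W.is_group by (auto simp: lhom_def)

lemma map_inv: "v \<in> carrier V \<Longrightarrow> \<phi> (inv\<^bsub>V\<^esub> v) = inv\<^bsub>W\<^esub> \<phi> v"
  using map(3)[of v "- 1"] map(1)[of v] by (simp add: V.lact_uminus_one W.lact_uminus_one)

lemma lsubmodule_vimage:
  assumes "lsubmodule X W" shows "lsubmodule {v \<in> carrier V. \<phi> v \<in> X} V"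
  using lsubmoduleD[OF assms] by (intro V.lsubmoduleI) (auto simp: map V.lact_closed)

lemma lsubmodule_image:
  assumes "lsubmodule X V" shows "lsubmodule (\<phi> ` X) W"
proof -
  note X = lsubmoduleD[OF assms]
  show ?thesis
  proof (intro W.lsubmoduleI)
    show "\<phi> ` X \<subseteq> carrier W" using X(2) map(1) by blast
    show "\<one>\<^bsub>W\<^esub> \<in> \<phi> ` X" using imageI[OF X(3), of \<phi>] by simp
    fix u assume "u \<in> \<phi> ` X"
    then obtain x where x: "x \<in> X" "u = \<phi> x" by blast
    then have xV: "x \<in> carrier V" using X(2) by blast
    show "h \<triangleright>\<^bsub>W\<^esub> u \<in> \<phi> ` X" for h
      using imageI[OF X(6)[OF x(1), of h], of \<phi>] x(2) by (simp add: map(3) xV)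
    fix w assume "w \<in> \<phi> ` X"
    then obtain y where y: "y \<in> X" "w = \<phi> y" by blast
    then have yV: "y \<in> carrier V" using X(2) by blast
    show "u \<otimes>\<^bsub>W\<^esub> w \<in> \<phi> ` X"
      using imageI[OF X(4)[OF x(1) y(1)], of \<phi>] x(2) y(2) by (simp add: map(2) xV yV)
  qed
qed

lemma inj_onI_kernel:
  assumes "lsubmodule X V" "\<And>v. v \<in> X \<Longrightarrow> \<phi> v = \<one>\<^bsub>W\<^esub> \<Longrightarrow> v = \<one>\<^bsub>V\<^esub>"
  shows "inj_on \<phi> X"
proof (rule inj_onI)
  note X = lsubmoduleD[OF assms(1)]
  fix x y assume xy: "x \<in> X" "y \<in> X" "\<phi> x = \<phi> y"
  then have c: "x \<in> carrier V" "y \<in> carrier V" using X(2) by auto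
  have "\<phi> (x \<otimes>\<^bsub>V\<^esub> inv\<^bsub>V\<^esub> y) = \<one>\<^bsub>W\<^esub>" using c xy map by (simp add: map_inv)
  then have "x \<otimes>\<^bsub>V\<^esub> inv\<^bsub>V\<^esub> y = \<one>\<^bsub>V\<^esub>" using assms(2) X(4,5) xy by blast
  then show "x = y" using c V.inv_equality[of x "inv\<^bsub>V\<^esub> y"] by simp
qed

text \<open>The preimage of \<open>X\<close> is a submodule of the simple module \<open>V\<close>.
  The conclusion has the form that \<open>complement_in_socle\<close> asks of its \<open>T\<close>,
  and it admits a zero image.\<close>

lemma image_of_simple:
  assumes "simple_lmodule V" "lsubmodule X W" "X \<subseteq> \<phi> ` carrier V"
  shows "X = {\<one>\<^bsub>W\<^esub>} \<or> X = \<phi> ` carrier V"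
proof -
  let ?Y = "{v \<in> carrier V. \<phi> v \<in> X}"
  have X: "X = \<phi> ` ?Y" using assms(3) by blast
  have "?Y = {\<one>\<^bsub>V\<^esub>} \<or> ?Y = carrier V"
    using assms(1) lsubmodule_vimage[OF assms(2)] unfolding simple_lmodule_def by blast
  then show ?thesis
  proof
    assume "?Y = {\<one>\<^bsub>V\<^esub>}"
    then have "X = \<phi> ` {\<one>\<^bsub>V\<^esub>}" using X by metis
    then show ?thesis by simp
  next
    assume "?Y = carrier V"
    then show ?thesis using X by metis
  qed
qed

text \<open>The kernel is a submodule, and \<open>v\<close> keeps it from being everything.\<close>

lemma inj_on_simple:
  assumes "simple_lmodule V" "v \<in> carrier V" "\<phi> v \<noteq> \<one>\<^bsub>W\<^esub>"
  shows "inj_on \<phi> (carrier V)"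
proof (rule inj_onI_kernel)
  show "lsubmodule (carrier V) V" by (rule V.lsubmodule_carrier)
  have "lsubmodule {v \<in> carrier V. \<phi> v \<in> {\<one>\<^bsub>W\<^esub>}} V"
    by (rule lsubmodule_vimage[OF W.lsubmodule_trivial])
  then have "{v \<in> carrier V. \<phi> v \<in> {\<one>\<^bsub>W\<^esub>}} = {\<one>\<^bsub>V\<^esub>}"
    using assms unfolding simple_lmodule_def by blast
  then show "x = \<one>\<^bsub>V\<^esub>" if "x \<in> carrier V" "\<phi> x = \<one>\<^bsub>W\<^esub>" for x
    using that by blast
qed

lemma schur:
  assumes "simple_lmodule V" "simple_lmodule W" "v \<in> carrier V" "\<phi> v \<noteq> \<one>\<^bsub>W\<^esub>"
  shows "lisomorphic V W"
proof -
  have "\<phi> ` carrier V = carrier W"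
    using lsubmodule_image[OF V.lsubmodule_carrier] assms(2-4) by (auto simp: simple_lmodule_def)
  then show ?thesis
    using lhom inj_on_simple[OF assms(1,3,4)] by (auto simp: lisomorphic_def bij_betw_def)
qed

end

lemma lisomorphicI: "\<phi> \<in> lhom V W \<Longrightarrow> bij_betw \<phi> (carrier V) (carrier W) \<Longrightarrow> lisomorphic V W"
  unfolding lisomorphic_def by (rule bexI)

lemma lisomorphicE:
  assumes "lisomorphic V W"
  obtains \<phi> where "\<phi> \<in> lhom V W" "bij_betw \<phi> (carrier V) (carrier W)"
  using assms unfolding lisomorphic_def by (elim bexE)

lemma lisomorphic_refl: "lisomorphic V V"
  by (rule lisomorphicI[of id]) (simp_all add: lhomI)

lemma lisomorphic_sym:
  assumes "left_module V" "lisomorphic V W" shows "lisomorphic W V"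
proof -
  obtain \<phi> where \<phi>: "\<phi> \<in> lhom V W" "bij_betw \<phi> (carrier V) (carrier W)"
    using assms(2) by (rule lisomorphicE)
  show ?thesis
    using inv_into_lhom[OF assms(1) \<phi>] bij_betw_inv_into[OF \<phi>(2)] by (rule lisomorphicI)
qed

lemma lisomorphic_trans:
  assumes "lisomorphic U V" "lisomorphic V W" shows "lisomorphic U W"
proof -
  from assms(1) obtain \<phi> where "\<phi> \<in> lhom U V" "bij_betw \<phi> (carrier U) (carrier V)"
    by (rule lisomorphicE)
  moreover from assms(2) obtain \<psi> where "\<psi> \<in> lhom V W" "bij_betw \<psi> (carrier V) (carrier W)"
    by (rule lisomorphicE)
  ultimately show ?thesis by (intro lisomorphicI[of "\<psi> \<circ> \<phi>"] lhom_comp bij_betw_trans)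
qed

lemma simple_lmodule_iso:
  assumes "left_module V" "left_module W" "lisomorphic V W" "simple_lmodule V"
  shows "simple_lmodule W"
proof -
  obtain \<phi> where \<phi>: "\<phi> \<in> lhom V W" "bij_betw \<phi> (carrier V) (carrier W)"
    using assms(3) by (rule lisomorphicE)
  interpret lmodule_hom V W \<phi>
    by (intro lmodule_hom.intro lmodule_hom_axioms.intro assms \<phi>)
  have im: "\<phi> ` carrier V = carrier W" and inj: "inj_on \<phi> (carrier V)"
    using \<phi>(2) by (auto simp: bij_betw_def)
  have "carrier W \<noteq> {\<one>\<^bsub>W\<^esub>}"
  proof
    assume "carrier W = {\<one>\<^bsub>W\<^esub>}"
    then have "\<phi> v = \<phi> \<one>\<^bsub>V\<^esub>" if "v \<in> carrier V" for v using that map(1) by fastforce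
    then have "carrier V = {\<one>\<^bsub>V\<^esub>}" using inj by (auto simp: inj_on_def)
    then show False using assms(4) by (simp add: simple_lmodule_def)
  qed
  moreover have "U = {\<one>\<^bsub>W\<^esub>} \<or> U = carrier W" if "lsubmodule U W" for U
    using image_of_simple[OF assms(4) that] lsubmoduleD(2)[OF that] im by simp
  ultimately show ?thesis by (simp add: simple_lmodule_def)
qed


section \<open>Complements and semisimplicity\<close>

context left_module
begin

text \<open>A submodule \<open>N\<close> maximal among those meeting \<open>S\<close> trivially: if \<open>N + T\<close> meets \<open>S\<close> in a
  nonzero \<open>s = n + t\<close>, then \<open>t\<close> is a nonzero element of \<open>T \<inter> (N + S)\<close>.\<close>

lemma complement_in_socle:
  assumes S: "lsubmodule S V"
  obtains N where "lsubmodule N V" "N \<inter> S = {\<one>}"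
    "\<And>T. lsubmodule T V \<Longrightarrow> (\<And>X. lsubmodule X V \<Longrightarrow> X \<subseteq> T \<Longrightarrow> X = {\<one>} \<or> X = T) \<Longrightarrow> T \<subseteq> N <#> S"
proof -
  let ?A = "{N. lsubmodule N V \<and> N \<inter> S = {\<one>}}"
  have "\<exists>N\<in>?A. \<forall>X\<in>?A. N \<subseteq> X \<longrightarrow> X = N"
  proof (rule subset_Zorn_nonempty)
    have "{\<one>} \<in> ?A" using lsubmodule_trivial lsubmoduleD(3)[OF S] by blast
    then show "?A \<noteq> {}" by blast
  next
    fix \<C> assume ne: "\<C> \<noteq> {}" and ch: "subset.chain ?A \<C>"
    then have C: "lsubmodule N V" "N \<inter> S = {\<one>}" if "N \<in> \<C>" for N
      using that unfolding subset.chain_def by blast+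
    have "lsubmodule (\<Union>\<C>) V"
    proof (rule lsubmoduleI)
      show "\<Union>\<C> \<subseteq> carrier V" using lsubmoduleD(2)[OF C(1)] by blast
      show "\<one> \<in> \<Union>\<C>" using ne lsubmoduleD(3)[OF C(1)] by blast
      show "h \<triangleright> u \<in> \<Union>\<C>" if "u \<in> \<Union>\<C>" for h u
        using that lsubmoduleD(6)[OF C(1)] by blast
      fix u w assume "u \<in> \<Union>\<C>" "w \<in> \<Union>\<C>"
      then obtain N N' where N: "N \<in> \<C>" "u \<in> N" "N' \<in> \<C>" "w \<in> N'" by blast
      then have "N \<subseteq> N' \<or> N' \<subseteq> N" using ch unfolding subset.chain_def by blast
      then show "u \<otimes> w \<in> \<Union>\<C>"
      proof
        assume "N \<subseteq> N'"
        then have "u \<otimes> w \<in> N'" using N lsubmoduleD(4)[OF C(1)[OF N(3)]] by blast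
        then show ?thesis using N(3) by blast
      next
        assume "N' \<subseteq> N"
        then have "u \<otimes> w \<in> N" using N lsubmoduleD(4)[OF C(1)[OF N(1)]] by blast
        then show ?thesis using N(1) by blast
      qed
    qed
    moreover have "\<Union>\<C> \<inter> S = {\<one>}" using ne C(2) by blast
    ultimately show "\<Union>\<C> \<in> ?A" by blast
  qed
  then obtain N where NA: "N \<in> ?A" and maxA: "\<forall>X\<in>?A. N \<subseteq> X \<longrightarrow> X = N"
    by (rule bexE)
  have N: "lsubmodule N V" "N \<inter> S = {\<one>}" using NA by simp_all
  have max: "X = N" if "lsubmodule X V" "X \<inter> S = {\<one>}" "N \<subseteq> X" for X
    using maxA that by simp
  have "T \<subseteq> N <#> S"
    if T: "lsubmodule T V" and Tmin: "\<And>X. lsubmodule X V \<Longrightarrow> X \<subseteq> T \<Longrightarrow> X = {\<one>} \<or> X = T" for T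
  proof (cases "(N <#> T) \<inter> S = {\<one>}")
    \<comment> \<open>Maximality absorbs \<open>T\<close> into \<open>N\<close>.\<close>
    case True
    then have "N <#> T = N"
      using max lsubmodule_set_mult[OF N(1) T] set_mult_upper(1)[OF N(1) T] by blast
    then show ?thesis using set_mult_upper(2)[OF N(1) T] set_mult_upper(1)[OF N(1) S] by blast
  next
    case False
    have "\<one> \<in> (N <#> T) \<inter> S"
      using lsubmoduleD(3)[OF lsubmodule_set_mult[OF N(1) T]] lsubmoduleD(3)[OF S] by blast
    with False obtain s where s: "s \<in> N <#> T" "s \<in> S" "s \<noteq> \<one>" by blast
    from s(1) obtain n t where nt: "n \<in> N" "t \<in> T" "s = n \<otimes> t" by (rule set_multE)
    have c: "n \<in> carrier V" "t \<in> carrier V" "s \<in> carrier V"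
      using nt s(2) lsubmoduleD(2)[OF N(1)] lsubmoduleD(2)[OF T] lsubmoduleD(2)[OF S] by blast+
    have "t = inv n \<otimes> s" using c nt(3) by (simp add: inv_solve_left)
    then have "t \<in> N <#> S" using set_multI[OF lsubmoduleD(5)[OF N(1) nt(1)] s(2)] by simp
    moreover have "t \<noteq> \<one>"
    proof
      assume "t = \<one>"
      then have "s \<in> N" using nt(1,3) c(1) by simp
      then show False using N(2) s(2,3) by blast
    qed
    moreover have "T \<inter> (N <#> S) = {\<one>} \<or> T \<inter> (N <#> S) = T"
      by (intro Tmin lsubmodule_Int lsubmodule_set_mult T N S) blast
    ultimately show ?thesis using nt(2) by blast
  qed
  then show ?thesis using that N by blast
qed

text \<open>Half of the modular law: if \<open>y = w + s\<close> with \<open>s\<close> in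
  \<open>S \<subseteq> Y\<close>, then \<open>w = y - s\<close> lies in \<open>Y\<close>.\<close>

lemma modular_sum:
  assumes "lsubmodule W V" "lsubmodule S V" "lsubmodule Y V" "S \<subseteq> Y" "carrier V \<subseteq> W <#> S"
  shows "Y \<subseteq> (W \<inter> Y) <#> S"
proof
  fix y assume y: "y \<in> Y"
  then have "y \<in> W <#> S" using assms(5) lsubmoduleD(2)[OF assms(3)] by blast
  then obtain w s where ws: "w \<in> W" "s \<in> S" "y = w \<otimes> s" by (rule set_multE)
  have c: "w \<in> carrier V" "s \<in> carrier V" "y \<in> carrier V"
    using ws y lsubmoduleD(2)[OF assms(1)] lsubmoduleD(2)[OF assms(2)] lsubmoduleD(2)[OF assms(3)]
    by blast+
  have "w = y \<otimes> inv s" using c ws(3) by (simp add: inv_solve_right)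
  then have "w \<in> Y"
    using lsubmoduleD(4)[OF assms(3) y lsubmoduleD(5)[OF assms(3)]] ws(2) assms(4) by blast
  then show "y \<in> (W \<inter> Y) <#> S" unfolding ws(3) using ws(1,2) by (intro set_multI) auto
qed

text \<open>If \<open>w = x + s\<close>, then \<open>s = w - x\<close> lies in
  \<open>W \<inter> S\<close> and vanishes. When \<open>W\<close> is a complement of
  \<open>S\<close>, this and \<open>modular_sum\<close> make \<open>X \<mapsto> X + S\<close> an
  order isomorphism from the submodules of \<open>W\<close> onto the submodules of \<open>V\<close>
  that contain \<open>S\<close>.\<close>

lemma modular_Int:
  assumes "lsubmodule W V" "lsubmodule S V" "lsubmodule X V" "X \<subseteq> W" "W \<inter> S = {\<one>}"
  shows "W \<inter> (X <#> S) = X"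
proof
  show "X \<subseteq> W \<inter> (X <#> S)" using assms(4) set_mult_upper(1)[OF assms(3,2)] by blast
  show "W \<inter> (X <#> S) \<subseteq> X"
  proof
    fix w assume "w \<in> W \<inter> (X <#> S)"
    then have w: "w \<in> W" "w \<in> X <#> S" by auto
    from w(2) obtain x s where xs: "x \<in> X" "s \<in> S" "w = x \<otimes> s" by (rule set_multE)
    have c: "w \<in> carrier V" "s \<in> carrier V" "x \<in> carrier V"
      using w(1) xs lsubmoduleD(2)[OF assms(1)] lsubmoduleD(2)[OF assms(2)]
        lsubmoduleD(2)[OF assms(3)] by blast+
    have "s = inv x \<otimes> w" using c xs(3) by (simp add: inv_solve_left)
    then have "s \<in> W"
      using lsubmoduleD(4)[OF assms(1) lsubmoduleD(5)[OF assms(1)] w(1)] xs(1) assms(4) by blast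
    then have "s = \<one>" using assms(5) xs(2) by blast
    then show "w \<in> X" using xs c by simp
  qed
qed

end

section \<open>Composition series as chains of covers\<close>

lemma subgroup_lmodule_of_iff: "subgroup U (lmodule_of G l) \<longleftrightarrow> subgroup U G"
  by (simp add: subgroup_def lmodule_of_def m_inv_def)

text \<open>From the correspondence theorem: a submodule \<open>X\<close> above \<open>A\<close> is
  the union of the cosets in its image, so simplicity of the quotient says that \<open>V\<close>
  covers \<open>A\<close> in the lattice of submodules.\<close>

lemma simple_lquotientD:
  fixes V :: "('h::{ring, monoid_mult}, 'm) lmodule"
  assumes "left_module V" and A: "lsubmodule A V" and simple: "simple_lmodule (lquotient V A)"
  shows "A \<noteq> carrier V"
    and "\<And>X. lsubmodule X V \<Longrightarrow> A \<subseteq> X \<Longrightarrow> X = A \<or> X = carrier V"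
proof -
  interpret left_module V by fact
  interpret normal A V using subgroup_imp_normal lsubmoduleD(1)[OF A] .
  let ?Q = "lquotient V A" and ?\<pi> = "\<lambda>x. A #>\<^bsub>V\<^esub> x"
  have carrier_Q: "carrier ?Q = ?\<pi> ` carrier V" and one_Q: "\<one>\<^bsub>?Q\<^esub> = A"
    by (simp_all add: lquotient_def lmodule_of_def carrier_FactGroup)
  have self: "x \<in> ?\<pi> x" if "x \<in> carrier V" for x
    using that lsubmoduleD(1)[OF A] by (rule rcos_self)
  show "A \<noteq> carrier V"
  proof
    assume "A = carrier V"
    then have "?\<pi> ` carrier V = {A}" using rcos_const[OF is_group] by auto
    then show False using simple carrier_Q one_Q unfolding simple_lmodule_def by simp
  qed
  fix X assume X: "lsubmodule X V" and AX: "A \<subseteq> X"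
  note XD = lsubmoduleD[OF X]
  have act: "h \<triangleright>\<^bsub>?Q\<^esub> ?\<pi> x = ?\<pi> (h \<triangleright>\<^bsub>V\<^esub> x)" if "x \<in> carrier V" for h x
  proof -
    have "?\<pi> (h \<triangleright>\<^bsub>V\<^esub> v) = ?\<pi> (h \<triangleright>\<^bsub>V\<^esub> x)" if "v \<in> ?\<pi> x" for v
    proof -
      obtain a where a: "a \<in> A" "v = a \<otimes>\<^bsub>V\<^esub> x" using \<open>v \<in> ?\<pi> x\<close> by (auto simp: r_coset_def)
      then have aV: "a \<in> carrier V" using lsubmoduleD(2)[OF A] by blast
      have "h \<triangleright>\<^bsub>V\<^esub> v \<in> ?\<pi> (h \<triangleright>\<^bsub>V\<^esub> x)"
        using lsubmoduleD(6)[OF A a(1), of h] \<open>x \<in> carrier V\<close> aV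
        unfolding a(2) by (auto simp: r_coset_def lact_add_right)
      then show ?thesis
        using repr_independence lsubmoduleD(1)[OF A] lact_closed[OF \<open>x \<in> carrier V\<close>] by metis
    qed
    then have "(\<Union>v\<in>?\<pi> x. ?\<pi> (h \<triangleright>\<^bsub>V\<^esub> v)) = ?\<pi> (h \<triangleright>\<^bsub>V\<^esub> x)"
      using self[OF that] by (intro SUP_eq_const) blast+
    then show ?thesis by (simp add: lquotient_def lmodule_of_def)
  qed
  have hom: "group_hom V (V Mod A) ?\<pi>"
    by (intro group_hom.intro group_hom_axioms.intro is_group factorgroup_is_group r_coset_hom_Mod)
  have "subgroup (?\<pi> ` X) ?Q"
    using group_hom.subgroup_img_is_subgroup[OF hom XD(1)]
    by (simp add: lquotient_def subgroup_lmodule_of_iff)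
  moreover have "h \<triangleright>\<^bsub>?Q\<^esub> u \<in> ?\<pi> ` X" if u: "u \<in> ?\<pi> ` X" for h u
  proof -
    obtain x where x: "x \<in> X" "u = ?\<pi> x" using u by blast
    then have "x \<in> carrier V" using XD(2) by blast
    then show ?thesis using act x XD(6)[OF x(1)] by auto
  qed
  ultimately have "lsubmodule (?\<pi> ` X) ?Q" by (simp add: lsubmodule_def)
  then have "?\<pi> ` X = {A} \<or> ?\<pi> ` X = ?\<pi> ` carrier V"
    using simple carrier_Q one_Q unfolding simple_lmodule_def by auto
  then show "X = A \<or> X = carrier V"
  proof
    assume *: "?\<pi> ` X = {A}"
    have "x \<in> A" if "x \<in> X" for x
    proof -
      have "?\<pi> x = A" using * that by blast
      then show ?thesis using self that XD(2) by blast
    qed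
    then show ?thesis using AX by blast
  next
    assume *: "?\<pi> ` X = ?\<pi> ` carrier V"
    have "v \<in> X" if v: "v \<in> carrier V" for v
    proof -
      have "?\<pi> v \<in> ?\<pi> ` X" using * v by simp
      then obtain x where x: "x \<in> X" "?\<pi> v = ?\<pi> x" by blast
      then have "v \<in> ?\<pi> x" using self v by metis
      then obtain a where "a \<in> A" "v = a \<otimes>\<^bsub>V\<^esub> x" by (auto simp: r_coset_def)
      then show ?thesis using AX x XD(4) by blast
    qed
    then show ?thesis using XD(2) by blast
  qed
qed

text \<open>\<open>finite_length\<close> rephrased without quotient modules: consecutive terms are
  covers in the lattice of submodules of \<open>V\<close>. In this form the modular law carries a
  chain over to a complement.\<close>

definition composition_chain :: "('h, 'm) lmodule \<Rightarrow> nat \<Rightarrow> (nat \<Rightarrow> 'm set) \<Rightarrow> bool"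
  where "composition_chain V n U \<longleftrightarrow> U 0 = {\<one>\<^bsub>V\<^esub>} \<and> U n = carrier V \<and>
    (\<forall>i\<le>n. lsubmodule (U i) V) \<and>
    (\<forall>i<n. U i \<subset> U (Suc i) \<and>
       (\<forall>X. lsubmodule X V \<longrightarrow> U i \<subseteq> X \<longrightarrow> X \<subseteq> U (Suc i) \<longrightarrow> X = U i \<or> X = U (Suc i)))"

lemma finite_length_composition_chain:
  assumes "left_module V" "finite_length V"
  obtains n U where "composition_chain V n U"
proof -
  interpret left_module V by fact
  obtain n :: nat and U where U: "U 0 = {\<one>\<^bsub>V\<^esub>}" "U n = carrier V" "\<forall>i\<le>n. lsubmodule (U i) V"
    and s: "\<forall>i<n. U i \<subseteq> U (Suc i) \<and> simple_lmodule (lquotient (V\<lparr>carrier := U (Suc i)\<rparr>) (U i))"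
    using assms(2) unfolding finite_length_def by blast
  have "U i \<subset> U (Suc i) \<and>
    (\<forall>X. lsubmodule X V \<longrightarrow> U i \<subseteq> X \<longrightarrow> X \<subseteq> U (Suc i) \<longrightarrow> X = U i \<or> X = U (Suc i))"
    if i: "i < n" for i
  proof -
    have B: "lsubmodule (U (Suc i)) V" and A: "lsubmodule (U i) V" and AB: "U i \<subseteq> U (Suc i)"
      using U(3) s i by auto
    let ?B = "V\<lparr>carrier := U (Suc i)\<rparr>"
    have "lsubmodule (U i) ?B" using lsubmodule_restrict_iff[OF B] A AB by simp
    note * = simple_lquotientD[OF left_module_restrict[OF B] this]
    have "simple_lmodule (lquotient ?B (U i))" using s i by blast
    then show ?thesis using *(1) *(2) AB lsubmodule_restrict_iff[OF B] by auto
  qed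
  then show ?thesis using that U unfolding composition_chain_def by blast
qed

text \<open>Adding \<open>U 1\<close> identifies the submodules of \<open>W\<close> with the
  submodules of \<open>V\<close> above \<open>U 1\<close>, so the part of the chain above
  \<open>U 1\<close> becomes a chain of \<open>W\<close>. The index starts at 1 because
  \<open>W \<inter> U 1\<close> is already zero. One step is lost, which drives the later
  induction.\<close>

lemma composition_chain_complement:
  assumes "left_module V" and chain: "composition_chain V (Suc n) U"
    and W: "lsubmodule W V" and WU: "W \<inter> U 1 = {\<one>\<^bsub>V\<^esub>}" and span: "carrier V \<subseteq> W <#>\<^bsub>V\<^esub> U 1"
  shows "composition_chain (V\<lparr>carrier := W\<rparr>) n (\<lambda>i. W \<inter> U (Suc i))"
proof -
  interpret left_module V by fact
  have U: "U (Suc n) = carrier V" "\<And>i. i \<le> Suc n \<Longrightarrow> lsubmodule (U i) V"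
    and mono: "\<And>i. i < Suc n \<Longrightarrow> U i \<subset> U (Suc i)"
    and cover: "\<And>i X. i < Suc n \<Longrightarrow> lsubmodule X V \<Longrightarrow> U i \<subseteq> X \<Longrightarrow> X \<subseteq> U (Suc i)
      \<Longrightarrow> X = U i \<or> X = U (Suc i)"
    using chain unfolding composition_chain_def by blast+
  have U1: "lsubmodule (U 1) V" by (rule U) simp
  have U1_le: "U 1 \<subseteq> U (Suc i)" if "i \<le> n" for i
    using that
  proof (induction i)
    case (Suc i)
    then show ?case using mono[of "Suc i"] by auto
  qed simp
  have sum: "U (Suc i) \<subseteq> (W \<inter> U (Suc i)) <#>\<^bsub>V\<^esub> U 1" if "i \<le> n" for i
    using that by (intro modular_sum W U1 U U1_le span) auto
  have "W \<inter> U (Suc i) \<subset> W \<inter> U (Suc (Suc i))" if i: "i < n" for i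
  proof -
    have less: "U (Suc i) \<subset> U (Suc (Suc i))" using mono i by simp
    \<comment> \<open>Equality would put \<open>U (Suc (Suc i))\<close> inside
      \<open>(W \<inter> U (Suc i)) + U 1\<close>, hence inside \<open>U (Suc i)\<close>.\<close>
    have "W \<inter> U (Suc i) \<noteq> W \<inter> U (Suc (Suc i))"
    proof
      assume eq: "W \<inter> U (Suc i) = W \<inter> U (Suc (Suc i))"
      have "(W \<inter> U (Suc i)) <#>\<^bsub>V\<^esub> U 1 \<subseteq> U (Suc i)"
        using i by (intro set_mult_least U U1_le) auto
      then show False using sum[of "Suc i"] i less eq by auto
    qed
    then show ?thesis using less by blast
  qed
  moreover have "X = W \<inter> U (Suc i) \<or> X = W \<inter> U (Suc (Suc i))"
    if i: "i < n" and X: "lsubmodule X V" "X \<subseteq> W" "W \<inter> U (Suc i) \<subseteq> X" "X \<subseteq> W \<inter> U (Suc (Suc i))"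
    for i X
  proof -
    \<comment> \<open>\<open>X + U 1\<close> lies between two consecutive terms of the chain, so it
      is one of them; meeting it with \<open>W\<close> gives \<open>X\<close> back.\<close>
    let ?Y = "X <#>\<^bsub>V\<^esub> U 1"
    have "U (Suc i) \<subseteq> ?Y"
      using sum[of i] i X(3) mono_set_mult[of "W \<inter> U (Suc i)" X "U 1" "U 1" V] by auto
    moreover have "?Y \<subseteq> U (Suc (Suc i))"
      using i X(4) by (intro set_mult_least U U1_le) auto
    ultimately have "?Y = U (Suc i) \<or> ?Y = U (Suc (Suc i))"
      using cover[of "Suc i" ?Y] i lsubmodule_set_mult[OF X(1) U1] by auto
    then show ?thesis using modular_Int[OF W U1 X(1,2) WU] by auto
  qed
  moreover have "lsubmodule (W \<inter> U (Suc i)) (V\<lparr>carrier := W\<rparr>)" if "i \<le> n" for i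
    using that lsubmodule_Int[OF W U(2)] by (simp add: lsubmodule_restrict_iff[OF W])
  ultimately show ?thesis
    using WU U(1) lsubmoduleD(2)[OF W]
    by (auto simp: composition_chain_def lsubmodule_restrict_iff[OF W])
qed

lemma composition_chain_simple:
  assumes "left_module V" "composition_chain V (Suc n) U"
  shows "simple_lmodule (V\<lparr>carrier := U 1\<rparr>)"
proof -
  interpret left_module V by fact
  note chain = assms(2)[unfolded composition_chain_def]
  have U0: "U 0 = {\<one>\<^bsub>V\<^esub>}" and U1: "lsubmodule (U 1) V" and less: "U 0 \<subset> U (Suc 0)"
    using chain by (simp, simp, blast)
  have cover: "X = U 0 \<or> X = U (Suc 0)"
    if "lsubmodule X V" "U 0 \<subseteq> X" "X \<subseteq> U (Suc 0)" for X
    using chain that by blast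
  have "X = {\<one>\<^bsub>V\<^esub>} \<or> X = U 1" if "lsubmodule X V" "X \<subseteq> U 1" for X
    using cover[OF that(1)] lsubmoduleD(3)[OF that(1)] that(2) U0 by simp
  then show ?thesis
    using less unfolding simple_lmodule_def lsubmodule_restrict_iff[OF U1] U0 by simp
qed

section \<open>Finite direct sums and splitting off a summand\<close>

lemma
  fixes M :: "'i \<Rightarrow> ('h::{ring, monoid_mult}, 'm) lmodule"
  assumes "\<And>i. i \<in> I \<Longrightarrow> left_module (M i)"
  shows ldirect_sum_carrier:
      "finite I \<Longrightarrow> carrier (ldirect_sum I M) = (\<Pi>\<^sub>E i\<in>I. carrier (M i))"
    and ldirect_sum_mult: "x \<otimes>\<^bsub>ldirect_sum I M\<^esub> y = (\<lambda>i\<in>I. x i \<otimes>\<^bsub>M i\<^esub> y i)"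
    and ldirect_sum_lact: "h \<triangleright>\<^bsub>ldirect_sum I M\<^esub> x = (\<lambda>i\<in>I. h \<triangleright>\<^bsub>M i\<^esub> x i)"
proof -
  have "group (M i)" if "i \<in> I" for i
    using assms[OF that] by (simp add: left_module_def comm_group_def)
  then show "finite I \<Longrightarrow> carrier (ldirect_sum I M) = (\<Pi>\<^sub>E i\<in>I. carrier (M i))"
    by (auto simp: ldirect_sum_def lmodule_of_def carrier_sum_group)
qed (simp_all add: ldirect_sum_def lmodule_of_def)

text \<open>Two decompositions \<open>w + s = w' + s'\<close> give \<open>w - w' = s' - s\<close>,
  an element of \<open>W \<inter> S\<close>, so they agree. The projections are chosen pointwise,
  and uniqueness makes them homomorphisms.\<close>

lemma direct_decomposition:
  assumes "left_module V" and W: "lsubmodule W V" and S: "lsubmodule S V"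
    and int: "W \<inter> S = {\<one>\<^bsub>V\<^esub>}" and span: "carrier V \<subseteq> W <#>\<^bsub>V\<^esub> S"
  obtains p q where "p \<in> lhom V (V\<lparr>carrier := W\<rparr>)" "q \<in> lhom V (V\<lparr>carrier := S\<rparr>)"
    "\<And>w s. w \<in> W \<Longrightarrow> s \<in> S \<Longrightarrow> p (w \<otimes>\<^bsub>V\<^esub> s) = w" "\<And>w s. w \<in> W \<Longrightarrow> s \<in> S \<Longrightarrow> q (w \<otimes>\<^bsub>V\<^esub> s) = s"
    "\<And>v. v \<in> carrier V \<Longrightarrow> v = p v \<otimes>\<^bsub>V\<^esub> q v"
proof -
  interpret left_module V by fact
  note Wc = lsubmoduleD[OF W] and Sc = lsubmoduleD[OF S]
  have uniq: "w = w' \<and> s = s'"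
    if "w \<in> W" "s \<in> S" "w' \<in> W" "s' \<in> S" "w \<otimes>\<^bsub>V\<^esub> s = w' \<otimes>\<^bsub>V\<^esub> s'" for w s w' s'
  proof -
    have c: "w \<in> carrier V" "w' \<in> carrier V" "s \<in> carrier V" "s' \<in> carrier V"
      using that Wc(2) Sc(2) by blast+
    have "inv\<^bsub>V\<^esub> w' \<otimes>\<^bsub>V\<^esub> w = s' \<otimes>\<^bsub>V\<^esub> inv\<^bsub>V\<^esub> s"
      using c that(5) by (metis inv_closed inv_solve_left' inv_solve_right' m_assoc m_closed)
    then have "inv\<^bsub>V\<^esub> w' \<otimes>\<^bsub>V\<^esub> w \<in> W \<inter> S"
      using Wc(4)[OF Wc(5)[OF that(3)] that(1)] Sc(4)[OF that(4) Sc(5)[OF that(2)]] by simp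
    then have "inv\<^bsub>V\<^esub> w' \<otimes>\<^bsub>V\<^esub> w = \<one>\<^bsub>V\<^esub>" using int by blast
    then have "inv\<^bsub>V\<^esub> (inv\<^bsub>V\<^esub> w) = inv\<^bsub>V\<^esub> (inv\<^bsub>V\<^esub> w')"
      using c inv_equality[of "inv\<^bsub>V\<^esub> w'" w] by simp
    then have "w = w'" using inv_inv[OF c(1)] inv_inv[OF c(2)] by simp
    then show ?thesis using that(5) c by simp
  qed
  have "\<exists>w s. w \<in> W \<and> s \<in> S \<and> v = w \<otimes>\<^bsub>V\<^esub> s" if "v \<in> carrier V" for v
  proof -
    have "v \<in> W <#>\<^bsub>V\<^esub> S" using span that by blast
    then show ?thesis by (rule set_multE) blast
  qed
  then obtain p q where pq: "\<And>v. v \<in> carrier V \<Longrightarrow> p v \<in> W \<and> q v \<in> S \<and> v = p v \<otimes>\<^bsub>V\<^esub> q v"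
    by metis
  have eq: "p (w \<otimes>\<^bsub>V\<^esub> s) = w \<and> q (w \<otimes>\<^bsub>V\<^esub> s) = s" if ws: "w \<in> W" "s \<in> S" for w s
  proof -
    have "w \<otimes>\<^bsub>V\<^esub> s \<in> carrier V" using ws Wc(2) Sc(2) by (meson m_closed subsetD)
    note * = pq[OF this]
    show ?thesis using uniq[of "p (w \<otimes>\<^bsub>V\<^esub> s)" "q (w \<otimes>\<^bsub>V\<^esub> s)" w s] * ws by metis
  qed
  have add: "p (x \<otimes>\<^bsub>V\<^esub> y) = p x \<otimes>\<^bsub>V\<^esub> p y \<and> q (x \<otimes>\<^bsub>V\<^esub> y) = q x \<otimes>\<^bsub>V\<^esub> q y"
    if "x \<in> carrier V" "y \<in> carrier V" for x y
  proof -
    note px = pq[OF that(1)] and py = pq[OF that(2)]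
    have c: "p x \<in> carrier V" "q x \<in> carrier V" "p y \<in> carrier V" "q y \<in> carrier V"
      using px py Wc(2) Sc(2) by blast+
    have "x \<otimes>\<^bsub>V\<^esub> y = (p x \<otimes>\<^bsub>V\<^esub> q x) \<otimes>\<^bsub>V\<^esub> (p y \<otimes>\<^bsub>V\<^esub> q y)" using px py by metis
    also have "\<dots> = (p x \<otimes>\<^bsub>V\<^esub> p y) \<otimes>\<^bsub>V\<^esub> (q x \<otimes>\<^bsub>V\<^esub> q y)" using c by (simp add: m_ac)
    finally show ?thesis using eq[of "p x \<otimes>\<^bsub>V\<^esub> p y" "q x \<otimes>\<^bsub>V\<^esub> q y"] px py Wc(4) Sc(4) by metis
  qed
  have act: "p (h \<triangleright>\<^bsub>V\<^esub> x) = h \<triangleright>\<^bsub>V\<^esub> p x \<and> q (h \<triangleright>\<^bsub>V\<^esub> x) = h \<triangleright>\<^bsub>V\<^esub> q x" if "x \<in> carrier V" for h x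
  proof -
    note px = pq[OF that]
    have c: "p x \<in> carrier V" "q x \<in> carrier V" using px Wc(2) Sc(2) by blast+
    have "h \<triangleright>\<^bsub>V\<^esub> x = h \<triangleright>\<^bsub>V\<^esub> (p x \<otimes>\<^bsub>V\<^esub> q x)" using px by metis
    also have "\<dots> = (h \<triangleright>\<^bsub>V\<^esub> p x) \<otimes>\<^bsub>V\<^esub> (h \<triangleright>\<^bsub>V\<^esub> q x)" using c by (rule lact_add_right)
    finally show ?thesis using eq[of "h \<triangleright>\<^bsub>V\<^esub> p x" "h \<triangleright>\<^bsub>V\<^esub> q x"] px Wc(6) Sc(6) by metis
  qed
  show ?thesis
  proof (rule that)
    show "p \<in> lhom V (V\<lparr>carrier := W\<rparr>)" "q \<in> lhom V (V\<lparr>carrier := S\<rparr>)"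
      using pq add act by (intro lhomI; simp)+
    show "p (w \<otimes>\<^bsub>V\<^esub> s) = w" "q (w \<otimes>\<^bsub>V\<^esub> s) = s" if "w \<in> W" "s \<in> S" for w s
      using eq[OF that] by auto
    show "v = p v \<otimes>\<^bsub>V\<^esub> q v" if "v \<in> carrier V" for v
      using pq[OF that] by blast
  qed
qed

text \<open>\<open>S\<close> takes the new index \<open>n\<close>: the isomorphism has the
  components of \<open>\<phi> (p v)\<close> below \<open>n\<close> and \<open>q v\<close> at
  \<open>n\<close>.\<close>

lemma ldirect_sum_extend:
  fixes V :: "('h::{ring, monoid_mult}, 'm) lmodule"
  assumes V: "left_module V" and W: "lsubmodule W V" and S: "lsubmodule S V"
    and int: "W \<inter> S = {\<one>\<^bsub>V\<^esub>}" and span: "carrier V \<subseteq> W <#>\<^bsub>V\<^esub> S"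
    and M: "\<And>i. i < n \<Longrightarrow> left_module (M i)"
    and iso: "lisomorphic (V\<lparr>carrier := W\<rparr>) (ldirect_sum {..<n} M)"
  shows "lisomorphic V (ldirect_sum {..<Suc n} (M(n := V\<lparr>carrier := S\<rparr>)))"
proof -
  interpret left_module V by fact
  let ?M = "M(n := V\<lparr>carrier := S\<rparr>)" and ?W = "V\<lparr>carrier := W\<rparr>"
  obtain p q where p: "p \<in> lhom V ?W" and q: "q \<in> lhom V (V\<lparr>carrier := S\<rparr>)"
    and pW: "\<And>w s. w \<in> W \<Longrightarrow> s \<in> S \<Longrightarrow> p (w \<otimes>\<^bsub>V\<^esub> s) = w"
    and qS: "\<And>w s. w \<in> W \<Longrightarrow> s \<in> S \<Longrightarrow> q (w \<otimes>\<^bsub>V\<^esub> s) = s"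
    and pq: "\<And>v. v \<in> carrier V \<Longrightarrow> v = p v \<otimes>\<^bsub>V\<^esub> q v"
    using direct_decomposition[OF V W S int span] by blast
  note pD = lhomD[OF p, simplified] and qD = lhomD[OF q, simplified]
  from iso obtain \<phi> where \<phi>: "\<phi> \<in> lhom ?W (ldirect_sum {..<n} M)"
    and bij: "bij_betw \<phi> (carrier ?W) (carrier (ldirect_sum {..<n} M))"
    by (rule lisomorphicE)
  have M1: "left_module (M i)" if "i \<in> {..<n}" for i using M that by simp
  have M2: "left_module (?M i)" if "i \<in> {..<Suc n}" for i
    using M that left_module_restrict[OF S] by (auto simp: less_Suc_eq)
  have D1: "carrier (ldirect_sum {..<n} M) = (\<Pi>\<^sub>E i\<in>{..<n}. carrier (M i))"
    "x \<otimes>\<^bsub>ldirect_sum {..<n} M\<^esub> y = (\<lambda>i\<in>{..<n}. x i \<otimes>\<^bsub>M i\<^esub> y i)"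
    "h \<triangleright>\<^bsub>ldirect_sum {..<n} M\<^esub> x = (\<lambda>i\<in>{..<n}. h \<triangleright>\<^bsub>M i\<^esub> x i)" for x y h
    by (rule ldirect_sum_carrier ldirect_sum_mult ldirect_sum_lact finite_lessThan,
        erule M1 | rule finite_lessThan)+
  have D2: "carrier (ldirect_sum {..<Suc n} ?M) = (\<Pi>\<^sub>E i\<in>{..<Suc n}. carrier (?M i))"
    "x \<otimes>\<^bsub>ldirect_sum {..<Suc n} ?M\<^esub> y = (\<lambda>i\<in>{..<Suc n}. x i \<otimes>\<^bsub>?M i\<^esub> y i)"
    "h \<triangleright>\<^bsub>ldirect_sum {..<Suc n} ?M\<^esub> x = (\<lambda>i\<in>{..<Suc n}. h \<triangleright>\<^bsub>?M i\<^esub> x i)" for x y h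
    by (rule ldirect_sum_carrier ldirect_sum_mult ldirect_sum_lact finite_lessThan,
        erule M2 | rule finite_lessThan)+
  note \<phi>D = lhomD[OF \<phi>, simplified]
  have \<phi>c: "\<phi> w \<in> (\<Pi>\<^sub>E i\<in>{..<n}. carrier (M i))" if "w \<in> W" for w
    using \<phi>D(1)[OF that] D1(1) by simp
  define \<Phi> where "\<Phi> = (\<lambda>v. \<lambda>i\<in>{..<Suc n}. if i = n then q v else \<phi> (p v) i)"
  have \<Phi>n: "\<Phi> v n = q v" and \<Phi>i: "i < n \<Longrightarrow> \<Phi> v i = \<phi> (p v) i" for v i
    by (auto simp: \<Phi>_def)
  have ext: "x = y" if "x \<in> (\<Pi>\<^sub>E i\<in>{..<Suc n}. carrier (?M i))"
    "y \<in> (\<Pi>\<^sub>E i\<in>{..<Suc n}. carrier (?M i))" "\<And>i. i < n \<Longrightarrow> x i = y i" "x n = y n" for x y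
    using that by (intro PiE_ext[OF that(1,2)]) (auto simp: less_Suc_eq)
  have \<Phi>c: "\<Phi> v \<in> (\<Pi>\<^sub>E i\<in>{..<Suc n}. carrier (?M i))" if "v \<in> carrier V" for v
    using \<phi>c[OF pD(1)[OF that]] qD(1)[OF that]
    by (auto simp: \<Phi>_def PiE_iff less_Suc_eq)
  have "\<Phi> \<in> lhom V (ldirect_sum {..<Suc n} ?M)"
  proof (rule lhomI)
    show "\<Phi> v \<in> carrier (ldirect_sum {..<Suc n} ?M)" if "v \<in> carrier V" for v
      unfolding D2(1) by (rule \<Phi>c[OF that])
    show "\<Phi> (v \<otimes>\<^bsub>V\<^esub> w) = \<Phi> v \<otimes>\<^bsub>ldirect_sum {..<Suc n} ?M\<^esub> \<Phi> w"
      if "v \<in> carrier V" "w \<in> carrier V" for v w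
      unfolding D2(2) using that
      by (auto simp: \<Phi>_def fun_eq_iff pD qD \<phi>D D1(2) less_Suc_eq)
    show "\<Phi> (h \<triangleright>\<^bsub>V\<^esub> v) = h \<triangleright>\<^bsub>ldirect_sum {..<Suc n} ?M\<^esub> \<Phi> v" if "v \<in> carrier V" for h v
      unfolding D2(3) using that
      by (auto simp: \<Phi>_def fun_eq_iff pD qD \<phi>D D1(3) less_Suc_eq)
  qed
  moreover have "bij_betw \<Phi> (carrier V) (carrier (ldirect_sum {..<Suc n} ?M))"
  proof (rule bij_betw_imageI)
    show "inj_on \<Phi> (carrier V)"
    proof (rule inj_onI)
      fix v w assume vw: "v \<in> carrier V" "w \<in> carrier V" "\<Phi> v = \<Phi> w"
      have "\<phi> (p v) = \<phi> (p w)"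
        using vw(3) \<Phi>i by (intro PiE_ext[OF \<phi>c[OF pD(1)[OF vw(1)]] \<phi>c[OF pD(1)[OF vw(2)]]])
          (metis lessThan_iff)
      then have "p v = p w"
        using bij pD(1) vw(1,2) by (auto simp: bij_betw_def inj_on_def)
      moreover have "q v = q w" using vw(3) \<Phi>n by metis
      ultimately show "v = w" using pq vw(1,2) by metis
    qed
    show "\<Phi> ` carrier V = carrier (ldirect_sum {..<Suc n} ?M)"
    proof
      show "\<Phi> ` carrier V \<subseteq> carrier (ldirect_sum {..<Suc n} ?M)"
        unfolding D2(1) using \<Phi>c by blast
      show "carrier (ldirect_sum {..<Suc n} ?M) \<subseteq> \<Phi> ` carrier V"
      proof
        fix x assume "x \<in> carrier (ldirect_sum {..<Suc n} ?M)"
        then have x: "x \<in> (\<Pi>\<^sub>E i\<in>{..<Suc n}. carrier (?M i))" using D2(1) by simp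
        have xn: "x n \<in> S" using PiE_mem[OF x, of n] by simp
        have "x i \<in> carrier (M i)" if "i < n" for i using PiE_mem[OF x, of i] that by simp
        then have "restrict x {..<n} \<in> carrier (ldirect_sum {..<n} M)" unfolding D1(1) by auto
        also have "\<dots> = \<phi> ` W" using bij by (simp add: bij_betw_def)
        finally obtain w where w: "w \<in> W" "\<phi> w = restrict x {..<n}"
          by (elim imageE) metis
        then have c: "w \<otimes>\<^bsub>V\<^esub> x n \<in> carrier V"
          using xn lsubmoduleD(2)[OF W] lsubmoduleD(2)[OF S] by (meson m_closed subsetD)
        have "\<Phi> (w \<otimes>\<^bsub>V\<^esub> x n) = x"
          using w(2) pW[OF w(1) xn] qS[OF w(1) xn] \<Phi>i \<Phi>n by (intro ext[OF \<Phi>c[OF c] x]) simp_all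
        then show "x \<in> \<Phi> ` carrier V" using imageI[OF c, of \<Phi>] by simp
      qed
    qed
  qed
  ultimately show ?thesis by (rule lisomorphicI)
qed

text \<open>Induction on the length of a composition chain: a complement of the bottom term has a
  chain that is one step shorter, and it is again an object by closure under submodules. The bottom
  term is simple, so complements of simple submodules suffice.\<close>

lemma semisimple_category_if_complements:
  fixes C :: "('h::{ring, monoid_mult}, 'v) lmodule set"
  assumes mod: "\<And>V. V \<in> C \<Longrightarrow> left_module V" and closed: "closed_under_submodules C"
    and fin: "\<And>V. V \<in> C \<Longrightarrow> finite_length V"
    and compl: "\<And>V S. V \<in> C \<Longrightarrow> lsubmodule S V \<Longrightarrow> simple_lmodule (V\<lparr>carrier := S\<rparr>) \<Longrightarrow>
      \<exists>W. lsubmodule W V \<and> W \<inter> S = {\<one>\<^bsub>V\<^esub>} \<and> carrier V \<subseteq> W <#>\<^bsub>V\<^esub> S"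
  shows "semisimple_category C"
proof -
  have sub: "V\<lparr>carrier := U\<rparr> \<in> C" if "V \<in> C" "lsubmodule U V" for V U
    using closed that unfolding closed_under_submodules_def by blast
  have "\<exists>(m::nat) M. (\<forall>i<m. M i \<in> simple_objects C) \<and> lisomorphic V (ldirect_sum {..<m} M)"
    if "V \<in> C" "composition_chain V n U" for V n U
    using that
  proof (induction n arbitrary: V U)
    case 0
    then have c: "carrier V = {\<one>\<^bsub>V\<^esub>}" by (metis composition_chain_def)
    have one: "\<one>\<^bsub>V\<^esub> \<otimes>\<^bsub>V\<^esub> \<one>\<^bsub>V\<^esub> = \<one>\<^bsub>V\<^esub>"
      using mod[OF 0(1)] by (simp add: left_module_def comm_group_def group_def monoid.l_one monoid.one_closed)
    let ?M = "\<lambda>i::nat. V"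
    have "carrier (ldirect_sum {..<0} ?M) = {\<lambda>_. undefined}"
      using mod[OF 0(1)] by (simp add: ldirect_sum_carrier)
    then have "lisomorphic V (ldirect_sum {..<0} ?M)"
      using mod[OF 0(1)]
      \<comment> \<open>The empty direct sum has the single element
        \<open>\<lambda>_. undefined\<close>, and \<open>V\<close> is zero here.\<close>
      by (intro lisomorphicI[of "\<lambda>_ _. undefined"] lhomI)
        (simp_all add: c ldirect_sum_mult ldirect_sum_lact bij_betw_def fun_eq_iff)
    then show ?case by (intro exI[of _ 0] exI[of _ ?M]) simp
  next
    case (Suc n)
    note V = mod[OF Suc.prems(1)]
    let ?S = "V\<lparr>carrier := U 1\<rparr>"
    have S: "lsubmodule (U 1) V"
      using Suc.prems(2) unfolding composition_chain_def by simp
    have simple: "simple_lmodule ?S" by (rule composition_chain_simple[OF V Suc.prems(2)])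
    obtain W where W: "lsubmodule W V" "W \<inter> U 1 = {\<one>\<^bsub>V\<^esub>}" "carrier V \<subseteq> W <#>\<^bsub>V\<^esub> U 1"
      using compl[OF Suc.prems(1) S simple] by blast
    obtain m :: nat and M where M: "\<forall>i<m. M i \<in> simple_objects C"
      and iso: "lisomorphic (V\<lparr>carrier := W\<rparr>) (ldirect_sum {..<m} M)"
      using Suc.IH[OF sub[OF Suc.prems(1) W(1)] composition_chain_complement[OF V Suc.prems(2) W]]
      by blast
    have "lisomorphic V (ldirect_sum {..<Suc m} (M(m := ?S)))"
      using M mod by (intro ldirect_sum_extend[OF V W(1) S W(2,3) _ iso]) (simp add: simple_objects_def)
    moreover have "\<forall>i<Suc m. (M(m := ?S)) i \<in> simple_objects C"
      using M sub[OF Suc.prems(1) S] simple by (auto simp: simple_objects_def less_Suc_eq)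
    ultimately show ?case by blast
  qed
  then show ?thesis
    unfolding semisimple_category_def
    using finite_length_composition_chain[OF mod fin] by metis
qed


section \<open>Separating non-isomorphic simple modules\<close>

text \<open>Pairs are needed because all modules share one carrier type, so a vector does not
  determine its module. For genuine module elements this is a left ideal of
  \<open>H\<close>.\<close>

definition annihilator :: "(('h, 'v) lmodule \<times> 'v) set \<Rightarrow> 'h set"
  where "annihilator P = {a. \<forall>(V, v)\<in>P. a \<triangleright>\<^bsub>V\<^esub> v = \<one>\<^bsub>V\<^esub>}"

definition elements_of_modules :: "(('h::{ring, monoid_mult}, 'v) lmodule \<times> 'v) set \<Rightarrow> bool"
  where "elements_of_modules P \<longleftrightarrow> (\<forall>(V, v)\<in>P. left_module V \<and> v \<in> carrier V)"

lemma annihilator_insert: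
  "a \<in> annihilator (insert (V, v) P) \<longleftrightarrow> a \<triangleright>\<^bsub>V\<^esub> v = \<one>\<^bsub>V\<^esub> \<and> a \<in> annihilator P"
  by (simp add: annihilator_def)

lemma
  assumes "elements_of_modules P"
  shows annihilator_zero: "0 \<in> annihilator P"
    and annihilator_add: "a \<in> annihilator P \<Longrightarrow> b \<in> annihilator P \<Longrightarrow> a + b \<in> annihilator P"
    and annihilator_diff: "a \<in> annihilator P \<Longrightarrow> b \<in> annihilator P \<Longrightarrow> a - b \<in> annihilator P"
    and annihilator_mult: "a \<in> annihilator P \<Longrightarrow> h * a \<in> annihilator P"
proof -
  have V: "left_module V" and v: "v \<in> carrier V" if "(V, v) \<in> P" for V v
    using assms that by (auto simp: elements_of_modules_def)
  show "0 \<in> annihilator P"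
    by (auto simp: annihilator_def intro!: left_module.lact_zero_left V v)
  show add: "a + b \<in> annihilator P" if "a \<in> annihilator P" "b \<in> annihilator P" for a b
  proof -
    have "(a + b) \<triangleright>\<^bsub>V\<^esub> v = \<one>\<^bsub>V\<^esub>" if P: "(V, v) \<in> P" for V v
    proof -
      interpret left_module V using V[OF P] .
      have "a \<triangleright>\<^bsub>V\<^esub> v = \<one>\<^bsub>V\<^esub>" "b \<triangleright>\<^bsub>V\<^esub> v = \<one>\<^bsub>V\<^esub>"
        using \<open>a \<in> annihilator P\<close> \<open>b \<in> annihilator P\<close> P by (auto simp: annihilator_def)
      then show ?thesis using lact_add_left[OF v[OF P], of a b] by simp
    qed
    then show ?thesis by (auto simp: annihilator_def)
  qed
  show mult: "h * a \<in> annihilator P" if "a \<in> annihilator P" for h a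
  proof -
    have "(h * a) \<triangleright>\<^bsub>V\<^esub> v = \<one>\<^bsub>V\<^esub>" if P: "(V, v) \<in> P" for V v
    proof -
      interpret left_module V using V[OF P] .
      have "a \<triangleright>\<^bsub>V\<^esub> v = \<one>\<^bsub>V\<^esub>"
        using \<open>a \<in> annihilator P\<close> P by (auto simp: annihilator_def)
      then show ?thesis using lact_mult[OF v[OF P], of h a] by simp
    qed
    then show ?thesis by (auto simp: annihilator_def)
  qed
  show "a - b \<in> annihilator P" if "a \<in> annihilator P" "b \<in> annihilator P"
    using add[OF that(1) mult[OF that(2), of "- 1"]] by simp
qed

text \<open>The annihilator is a left ideal, so it moves \<open>v\<close> through a submodule. For
  simple \<open>V\<close> the orbit is therefore zero or everything, the dichotomy on which the next
  two inductions rest.\<close>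

lemma lsubmodule_annihilator_orbit:
  assumes "left_module V" "v \<in> carrier V" "elements_of_modules P"
  shows "lsubmodule ((\<lambda>a. a \<triangleright>\<^bsub>V\<^esub> v) ` annihilator P) V"
proof -
  interpret left_module V by fact
  let ?X = "(\<lambda>a. a \<triangleright>\<^bsub>V\<^esub> v) ` annihilator P"
  show ?thesis
  proof (rule lsubmoduleI)
    show "?X \<subseteq> carrier V" using lact_closed[OF assms(2)] by blast
    show "\<one>\<^bsub>V\<^esub> \<in> ?X"
      using imageI[OF annihilator_zero[OF assms(3)], of "\<lambda>a. a \<triangleright>\<^bsub>V\<^esub> v"] lact_zero_left[OF assms(2)]
      by simp
    fix x assume "x \<in> ?X"
    then obtain a where a: "a \<in> annihilator P" "x = a \<triangleright>\<^bsub>V\<^esub> v" by blast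
    show "h \<triangleright>\<^bsub>V\<^esub> x \<in> ?X" for h
      using imageI[OF annihilator_mult[OF assms(3) a(1), of h], of "\<lambda>a. a \<triangleright>\<^bsub>V\<^esub> v"]
      by (simp add: a(2) lact_mult assms(2))
    fix y assume "y \<in> ?X"
    then obtain b where b: "b \<in> annihilator P" "y = b \<triangleright>\<^bsub>V\<^esub> v" by blast
    show "x \<otimes>\<^bsub>V\<^esub> y \<in> ?X"
      using imageI[OF annihilator_add[OF assms(3) a(1) b(1)], of "\<lambda>a. a \<triangleright>\<^bsub>V\<^esub> v"]
      by (simp add: a(2) b(2) lact_add_left assms(2))
  qed
qed

text \<open>Were the annihilator of \<open>P \<union> {v}\<close>, but not that of \<open>P\<close>, to kill \<open>w\<close>, then \<open>a v \<mapsto> a w\<close> for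
  \<open>a\<close> annihilating \<open>P\<close> would be a well-defined nonzero homomorphism.\<close>

lemma annihilator_nonisomorphic:
  fixes W :: "('h::{ring, monoid_mult}, 'v) lmodule"
  assumes W: "left_module W" "simple_lmodule W" and w: "w \<in> carrier W"
    and "finite P" "elements_of_modules P"
    and "\<And>V v. (V, v) \<in> P \<Longrightarrow> simple_lmodule V \<and> \<not> lisomorphic V W"
    and "\<And>a. a \<in> annihilator P \<Longrightarrow> a \<triangleright>\<^bsub>W\<^esub> w = \<one>\<^bsub>W\<^esub>"
  shows "w = \<one>\<^bsub>W\<^esub>"
  using assms(4-)
proof (induction P rule: finite_induct)
  case empty
  have "1 \<triangleright>\<^bsub>W\<^esub> w = \<one>\<^bsub>W\<^esub>" using empty(3)[of 1] by (simp add: annihilator_def)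
  then show ?case using left_module.lact_one[OF W(1) w] by simp
next
  case (insert z P)
  obtain V v where z: "z = (V, v)" by (cases z)
  have P: "elements_of_modules P" and V: "left_module V" and v: "v \<in> carrier V"
    and simple: "simple_lmodule V" and noniso: "\<not> lisomorphic V W"
    using insert.prems(1,2) by (auto simp: z elements_of_modules_def)
  have killed: "a \<triangleright>\<^bsub>W\<^esub> w = \<one>\<^bsub>W\<^esub>" if "a \<in> annihilator P" "a \<triangleright>\<^bsub>V\<^esub> v = \<one>\<^bsub>V\<^esub>" for a
    using insert.prems(3)[of a] that by (simp add: z annihilator_insert)
  interpret V: left_module V by fact
  interpret W: left_module W by fact
  show ?case
  proof (rule insert.IH)
    fix a0 assume a0: "a0 \<in> annihilator P"
    have "(\<lambda>a. a \<triangleright>\<^bsub>V\<^esub> v) ` annihilator P = {\<one>\<^bsub>V\<^esub>} \<or> (\<lambda>a. a \<triangleright>\<^bsub>V\<^esub> v) ` annihilator P = carrier V"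
      using simple lsubmodule_annihilator_orbit[OF V v P] unfolding simple_lmodule_def by blast
    then show "a0 \<triangleright>\<^bsub>W\<^esub> w = \<one>\<^bsub>W\<^esub>"
    proof
      \<comment> \<open>In this case adding \<open>v\<close> to \<open>P\<close> does not shrink the
        annihilator.\<close>
      assume "(\<lambda>a. a \<triangleright>\<^bsub>V\<^esub> v) ` annihilator P = {\<one>\<^bsub>V\<^esub>}"
      then have "a0 \<triangleright>\<^bsub>V\<^esub> v = \<one>\<^bsub>V\<^esub>" using a0 by blast
      then show ?thesis using killed a0 by blast
    next
      assume onto: "(\<lambda>a. a \<triangleright>\<^bsub>V\<^esub> v) ` annihilator P = carrier V"
      have wd: "a \<triangleright>\<^bsub>W\<^esub> w = b \<triangleright>\<^bsub>W\<^esub> w"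
        if ab: "a \<in> annihilator P" "b \<in> annihilator P" "a \<triangleright>\<^bsub>V\<^esub> v = b \<triangleright>\<^bsub>V\<^esub> v" for a b
      proof -
        have "(a - b) \<triangleright>\<^bsub>W\<^esub> w = \<one>\<^bsub>W\<^esub>"
          using killed[OF annihilator_diff[OF P ab(1,2)] V.lact_diff_eq[OF v ab(3)]] .
        then show ?thesis
          using W.lact_add_left[OF w, of "a - b" b] W.lact_closed[OF w] by simp
      qed
      \<comment> \<open>Some \<open>a\<close> that carries \<open>v\<close> to \<open>x\<close> is
        picked; by \<open>wd\<close> the choice does not matter.\<close>
      define \<phi> where "\<phi> x = (SOME a. a \<in> annihilator P \<and> a \<triangleright>\<^bsub>V\<^esub> v = x) \<triangleright>\<^bsub>W\<^esub> w" for x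
      have \<phi>: "\<phi> (a \<triangleright>\<^bsub>V\<^esub> v) = a \<triangleright>\<^bsub>W\<^esub> w" if "a \<in> annihilator P" for a
      proof -
        have "(SOME b. b \<in> annihilator P \<and> b \<triangleright>\<^bsub>V\<^esub> v = a \<triangleright>\<^bsub>V\<^esub> v) \<in> annihilator P \<and>
            (SOME b. b \<in> annihilator P \<and> b \<triangleright>\<^bsub>V\<^esub> v = a \<triangleright>\<^bsub>V\<^esub> v) \<triangleright>\<^bsub>V\<^esub> v = a \<triangleright>\<^bsub>V\<^esub> v"
          by (rule someI) (use that in simp)
        then show ?thesis unfolding \<phi>_def using wd that by blast
      qed
      have rep: "\<exists>a\<in>annihilator P. x = a \<triangleright>\<^bsub>V\<^esub> v" if "x \<in> carrier V" for x
        using that onto by auto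
      have "\<phi> \<in> lhom V W"
      proof (rule lhomI)
        fix x assume "x \<in> carrier V"
        then obtain a where a: "a \<in> annihilator P" "x = a \<triangleright>\<^bsub>V\<^esub> v" using rep by blast
        show "\<phi> x \<in> carrier W" by (simp add: a \<phi> W.lact_closed w)
        show "\<phi> (h \<triangleright>\<^bsub>V\<^esub> x) = h \<triangleright>\<^bsub>W\<^esub> \<phi> x" for h
          using \<phi>[OF annihilator_mult[OF P a(1), of h]]
          by (simp add: a \<phi> W.lact_mult V.lact_mult v w)
        fix y assume "y \<in> carrier V"
        then obtain b where b: "b \<in> annihilator P" "y = b \<triangleright>\<^bsub>V\<^esub> v" using rep by blast
        show "\<phi> (x \<otimes>\<^bsub>V\<^esub> y) = \<phi> x \<otimes>\<^bsub>W\<^esub> \<phi> y"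
          using \<phi>[OF annihilator_add[OF P a(1) b(1)]]
          by (simp add: a b \<phi> W.lact_add_left V.lact_add_left v w)
      qed
      then interpret lmodule_hom V W \<phi>
        by unfold_locales
      show ?thesis
        using schur[OF simple W(2) V.lact_closed[OF v, of a0]] noniso \<phi>[OF a0] by metis
    qed
  qed (use insert.prems(2) P in auto)
qed

text \<open>Induction on \<open>E\<close>. An element \<open>a\<close> that works for
  \<open>E\<close> is corrected to \<open>a + c\<close>, where \<open>c\<close> kills
  \<open>P\<close> and \<open>E\<close> and sends \<open>w\<close> to \<open>w - a w\<close>. Such a
  \<open>c\<close> exists unless everything that kills \<open>P\<close> and \<open>E\<close> also
  kills \<open>w\<close>; in that case \<open>a\<close> turns out to fix \<open>w\<close>
  already.\<close>

lemma separating_element: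
  fixes W :: "('h::{ring, monoid_mult}, 'v) lmodule" and P :: "(('h, 'v) lmodule \<times> 'v) set"
  assumes W: "left_module W" "simple_lmodule W"
    and P: "finite P" "elements_of_modules P"
    and noniso: "\<And>V v. (V, v) \<in> P \<Longrightarrow> simple_lmodule V \<and> \<not> lisomorphic V W"
    and "finite E" "E \<subseteq> carrier W"
  shows "\<exists>a\<in>annihilator P. \<forall>w\<in>E. a \<triangleright>\<^bsub>W\<^esub> w = w"
  using assms(6,7)
proof (induction E rule: finite_induct)
  case empty
  then show ?case using annihilator_zero[OF P(2)] by auto
next
  case (insert w E)
  interpret left_module W by fact
  have w: "w \<in> carrier W" and E: "E \<subseteq> carrier W" using insert.prems by auto
  obtain a where a: "a \<in> annihilator P" and fix_E: "\<And>x. x \<in> E \<Longrightarrow> a \<triangleright>\<^bsub>W\<^esub> x = x"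
    using insert.IH[OF E] by blast
  let ?Q = "P \<union> Pair W ` E"
  have Q: "elements_of_modules ?Q"
    using P(2) W(1) E by (auto simp: elements_of_modules_def)
  have ann_Q: "b \<in> annihilator ?Q \<longleftrightarrow> b \<in> annihilator P \<and> (\<forall>x\<in>E. b \<triangleright>\<^bsub>W\<^esub> x = \<one>\<^bsub>W\<^esub>)" for b
    by (auto simp: annihilator_def)
  have "(\<lambda>b. b \<triangleright>\<^bsub>W\<^esub> w) ` annihilator ?Q = {\<one>\<^bsub>W\<^esub>} \<or> (\<lambda>b. b \<triangleright>\<^bsub>W\<^esub> w) ` annihilator ?Q = carrier W"
    using W(2) lsubmodule_annihilator_orbit[OF W(1) w Q] unfolding simple_lmodule_def by blast
  then show ?case
  proof
    assume triv: "(\<lambda>b. b \<triangleright>\<^bsub>W\<^esub> w) ` annihilator ?Q = {\<one>\<^bsub>W\<^esub>}"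
    \<comment> \<open>\<open>1 - a\<close> kills \<open>E\<close>, so for every \<open>c\<close>
      killing \<open>P\<close> the product \<open>c * (1 - a)\<close> kills \<open>P\<close> and
      \<open>E\<close>, and hence \<open>w\<close>. Thus \<open>(1 - a) w\<close> is killed by the
      whole annihilator of \<open>P\<close>.\<close>
    have killed: "c \<triangleright>\<^bsub>W\<^esub> ((1 - a) \<triangleright>\<^bsub>W\<^esub> w) = \<one>\<^bsub>W\<^esub>" if c: "c \<in> annihilator P" for c
    proof -
      have "c * (1 - a) = c - c * a" by (simp add: right_diff_distrib)
      then have "c * (1 - a) \<in> annihilator P"
        using annihilator_diff[OF P(2) c annihilator_mult[OF P(2) a, of c]] by simp
      moreover have "(c * (1 - a)) \<triangleright>\<^bsub>W\<^esub> x = \<one>\<^bsub>W\<^esub>" if "x \<in> E" for x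
      proof -
        have x: "x \<in> carrier W" using that E by blast
        have "(1 - a) \<triangleright>\<^bsub>W\<^esub> x = \<one>\<^bsub>W\<^esub>"
          using lact_diff_eq[OF x, of 1 a] fix_E[OF that] by (simp add: lact_one x)
        then show ?thesis by (simp add: lact_mult x)
      qed
      ultimately have "c * (1 - a) \<in> annihilator ?Q" by (simp add: ann_Q)
      then have "(c * (1 - a)) \<triangleright>\<^bsub>W\<^esub> w = \<one>\<^bsub>W\<^esub>" using triv by blast
      then show ?thesis by (simp add: lact_mult w)
    qed
    have "(1 - a) \<triangleright>\<^bsub>W\<^esub> w = \<one>\<^bsub>W\<^esub>"
      by (rule annihilator_nonisomorphic[OF W lact_closed[OF w] P]) (fact noniso, fact killed)
    then have "a \<triangleright>\<^bsub>W\<^esub> w = w"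
      using lact_add_left[OF w, of "1 - a" a] by (simp add: lact_one w lact_closed)
    then show ?thesis using a fix_E by blast
  next
    assume onto: "(\<lambda>b. b \<triangleright>\<^bsub>W\<^esub> w) ` annihilator ?Q = carrier W"
    have aw: "a \<triangleright>\<^bsub>W\<^esub> w \<in> carrier W" by (rule lact_closed[OF w])
    have "inv\<^bsub>W\<^esub> (a \<triangleright>\<^bsub>W\<^esub> w) \<otimes>\<^bsub>W\<^esub> w \<in> (\<lambda>b. b \<triangleright>\<^bsub>W\<^esub> w) ` annihilator ?Q"
      unfolding onto using aw w by simp
    then obtain c where c: "c \<in> annihilator ?Q" "c \<triangleright>\<^bsub>W\<^esub> w = inv\<^bsub>W\<^esub> (a \<triangleright>\<^bsub>W\<^esub> w) \<otimes>\<^bsub>W\<^esub> w"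
      by (elim imageE) metis
    have "(a + c) \<triangleright>\<^bsub>W\<^esub> w = w"
      using aw w by (simp add: lact_add_left c(2) flip: m_assoc)
    moreover have "(a + c) \<triangleright>\<^bsub>W\<^esub> x = x" if "x \<in> E" for x
    proof -
      have "c \<triangleright>\<^bsub>W\<^esub> x = \<one>\<^bsub>W\<^esub>" using c(1) that by (simp add: ann_Q)
      moreover have "x \<in> carrier W" using that E by blast
      ultimately show ?thesis using fix_E[OF that] by (simp add: lact_add_left)
    qed
    moreover have "a + c \<in> annihilator P"
      using annihilator_add[OF P(2) a] c(1) ann_Q by blast
    ultimately show ?thesis by blast
  qed
qed


section \<open>Matrix coefficients\<close>

definition coeff_data :: "(('h, 'v) lmodule \<Rightarrow> ('v \<Rightarrow> 'k) set) \<Rightarrow> ('h, 'v) lmodule set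
    \<Rightarrow> (('h, 'v) lmodule \<times> 'v \<times> ('v \<Rightarrow> 'k)) set"
  where "coeff_data St D = {(V, v, f). V \<in> D \<and> v \<in> carrier V \<and> f \<in> St V}"

definition coeff_sum :: "(('h, 'v) lmodule \<times> 'v \<times> ('v \<Rightarrow> 'k::field)) list \<Rightarrow> 'h \<Rightarrow> 'k"
  where "coeff_sum ps h = (\<Sum>(V, v, f)\<leftarrow>ps. f (h \<triangleright>\<^bsub>V\<^esub> v))"

text \<open>The sum of the coefficient spaces of the objects in \<open>D\<close>, encoded by finite
  lists of triples. For \<open>D = {V}\<close> it is the image of the map \<open>beta V\<close>, for
  \<open>D = simple_objects C\<close> the image of the natural map. Sums suffice, since a scalar
  factor can be absorbed into the vector.\<close>

definition coeffs :: "(('h, 'v) lmodule \<Rightarrow> ('v \<Rightarrow> 'k::field) set) \<Rightarrow> ('h, 'v) lmodule set \<Rightarrow> ('h \<Rightarrow> 'k) set"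
  where "coeffs St D = coeff_sum ` lists (coeff_data St D)"

lemma coeff_sum_Nil: "coeff_sum [] = (\<lambda>h. 0)"
  by (simp add: coeff_sum_def fun_eq_iff)

lemma coeff_sum_Cons: "coeff_sum ((V, v, f) # ps) = (\<lambda>h. f (h \<triangleright>\<^bsub>V\<^esub> v) + coeff_sum ps h)"
  by (simp add: coeff_sum_def fun_eq_iff)

lemma coeff_sum_append: "coeff_sum (ps @ qs) = (\<lambda>h. coeff_sum ps h + coeff_sum qs h)"
  by (simp add: coeff_sum_def fun_eq_iff)

lemma coeffs_zero: "(\<lambda>h. 0) \<in> coeffs St D"
  unfolding coeffs_def by (rule image_eqI[of _ _ "[]"]) (auto simp: coeff_sum_Nil)

lemma coeffs_single: "V \<in> D \<Longrightarrow> v \<in> carrier V \<Longrightarrow> f \<in> St V \<Longrightarrow> (\<lambda>h. f (h \<triangleright>\<^bsub>V\<^esub> v)) \<in> coeffs St D"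
  unfolding coeffs_def
  by (rule image_eqI[of _ _ "[(V, v, f)]"]) (auto simp: coeff_sum_Nil coeff_sum_Cons coeff_data_def)

lemma coeffs_add:
  assumes "\<xi> \<in> coeffs St D" "\<zeta> \<in> coeffs St D" shows "(\<lambda>h. \<xi> h + \<zeta> h) \<in> coeffs St D"
proof -
  obtain ps qs where "ps \<in> lists (coeff_data St D)" "\<xi> = coeff_sum ps"
    "qs \<in> lists (coeff_data St D)" "\<zeta> = coeff_sum qs"
    using assms unfolding coeffs_def by blast
  then show ?thesis
    unfolding coeffs_def by (intro image_eqI[of _ _ "ps @ qs"]) (simp_all add: coeff_sum_append)
qed

lemma coeffs_mono: "D \<subseteq> E \<Longrightarrow> coeffs St D \<subseteq> coeffs St E"
  unfolding coeffs_def by (intro image_mono lists_mono) (auto simp: coeff_data_def)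

lemma coeffs_induct [consumes 1, case_names zero add]:
  assumes "\<xi> \<in> coeffs St D" and zero: "P (\<lambda>h. 0)"
    and add: "\<And>V v f \<zeta>. V \<in> D \<Longrightarrow> v \<in> carrier V \<Longrightarrow> f \<in> St V \<Longrightarrow> P \<zeta> \<Longrightarrow> P (\<lambda>h. f (h \<triangleright>\<^bsub>V\<^esub> v) + \<zeta> h)"
  shows "P \<xi>"
proof -
  have "P (coeff_sum ps)" if "ps \<in> lists (coeff_data St D)" for ps
    using that
  proof (induction ps)
    case Nil
    then show ?case using zero by (simp add: coeff_sum_Nil)
  next
    case (Cons p ps)
    then show ?case using add by (cases p) (auto simp: coeff_sum_Cons coeff_data_def)
  qed
  then show ?thesis using assms(1) unfolding coeffs_def by blast
qed

lemma coeffs_sum: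
  "finite F \<Longrightarrow> (\<And>i. i \<in> F \<Longrightarrow> \<xi> i \<in> coeffs St D) \<Longrightarrow> (\<lambda>h. \<Sum>i\<in>F. \<xi> i h) \<in> coeffs St D"
  by (induction F rule: finite_induct) (auto intro: coeffs_zero coeffs_add)

section \<open>Functionals on objects and the module of functionals on \<open>H\<close>\<close>

locale dual_category = assoc_algebra scale
  for scale :: "'k::field \<Rightarrow> 'h::{ring, monoid_mult} \<Rightarrow> 'h" +
  fixes C :: "('h, 'v) lmodule set" and St :: "('h, 'v) lmodule \<Rightarrow> ('v \<Rightarrow> 'k) set"
  assumes module: "V \<in> C \<Longrightarrow> left_module V"
    and duality: "finite_duality_functor scale C St"
begin

lemma scale_one_mult: "scale a 1 * x = scale a x"
  using scale_mult_left[of a 1 x] by simp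

lemma
  assumes "V \<in> C" "f \<in> St V"
  shows functional_add: "\<And>v w. v \<in> carrier V \<Longrightarrow> w \<in> carrier V \<Longrightarrow> f (v \<otimes>\<^bsub>V\<^esub> w) = f v + f w"
    and functional_scale: "\<And>a v. v \<in> carrier V \<Longrightarrow> f (scale a 1 \<triangleright>\<^bsub>V\<^esub> v) = a * f v"
proof -
  have "rsubmodule (St V) (dual scale V)"
    using duality assms(1) by (simp add: finite_duality_functor_def)
  then have "St V \<subseteq> carrier (dual scale V)" by (simp add: rsubmodule_def subgroup_def)
  then have f: "f \<in> carrier (dual scale V)" using assms(2) by blast
  show "f (v \<otimes>\<^bsub>V\<^esub> w) = f v + f w" if "v \<in> carrier V" "w \<in> carrier V" for v w
    using f that by (simp add: dual_def)
  show "f (scale a 1 \<triangleright>\<^bsub>V\<^esub> v) = a * f v" if "v \<in> carrier V" for a v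
    using f that by (simp add: dual_def)
qed

lemma functional_one: assumes "V \<in> C" "f \<in> St V" shows "f \<one>\<^bsub>V\<^esub> = 0"
proof -
  interpret left_module V using module[OF assms(1)] .
  have "f \<one>\<^bsub>V\<^esub> = f \<one>\<^bsub>V\<^esub> + f \<one>\<^bsub>V\<^esub>"
    using functional_add[OF assms one_closed one_closed] by (simp only: l_one one_closed)
  then show ?thesis by (metis add_left_imp_eq add.right_neutral)
qed

lemma functional_transpose:
  assumes "V \<in> C" "W \<in> C" "\<phi> \<in> lhom V W" "f \<in> St W"
  shows "compose (carrier V) f \<phi> \<in> St V"
  using duality assms by (simp add: finite_duality_functor_def)

lemma functional_ract:
  assumes "V \<in> C" "f \<in> St V" shows "(\<lambda>v\<in>carrier V. f (h \<triangleright>\<^bsub>V\<^esub> v)) \<in> St V"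
proof -
  have "rsubmodule (St V) (dual scale V)"
    using duality assms(1) by (simp add: finite_duality_functor_def)
  then have "f \<triangleleft>\<^bsub>dual scale V\<^esub> h \<in> St V" using assms(2) by (simp add: rsubmodule_def)
  then show ?thesis by (simp add: dual_def)
qed

lemma functionals_separate:
  assumes "V \<in> C" "v \<in> carrier V" "v \<noteq> \<one>\<^bsub>V\<^esub>"
  obtains f where "f \<in> St V" "f v \<noteq> 0"
proof -
  have "\<forall>v\<in>carrier V. (\<forall>f\<in>St V. f v = 0) \<longrightarrow> v = \<one>\<^bsub>V\<^esub>"
    using duality assms(1) by (simp add: finite_duality_functor_def)
  then show ?thesis using that assms(2,3) by blast
qed

lemma Hdual_carrier_iff:
  "\<xi> \<in> carrier (Hdual scale) \<longleftrightarrow> (\<forall>x y. \<xi> (x + y) = \<xi> x + \<xi> y) \<and> (\<forall>a x. \<xi> (scale a x) = a * \<xi> x)"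
proof -
  have "vector_space scale" by unfold_locales
  moreover have "vector_space ((*) :: 'k \<Rightarrow> 'k \<Rightarrow> 'k)"
    by unfold_locales (simp_all add: algebra_simps)
  ultimately show ?thesis by (simp add: Hdual_def Vector_Spaces.linear_iff)
qed

lemma Hdual_simps [simp]:
  "\<xi> \<otimes>\<^bsub>Hdual scale\<^esub> \<zeta> = (\<lambda>x. \<xi> x + \<zeta> x)" "\<one>\<^bsub>Hdual scale\<^esub> = (\<lambda>x. 0)"
  "h \<triangleright>\<^bsub>Hdual scale\<^esub> \<xi> = (\<lambda>x. \<xi> (x * h))" "bract (Hdual scale) \<xi> h = (\<lambda>x. \<xi> (h * x))"
  by (simp_all add: Hdual_def)

lemma left_module_Hdual: "left_module (Hdual scale)"
proof -
  have "comm_group (Hdual scale)"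
  proof (rule comm_groupI)
    show "\<exists>\<zeta>\<in>carrier (Hdual scale). \<zeta> \<otimes>\<^bsub>Hdual scale\<^esub> \<xi> = \<one>\<^bsub>Hdual scale\<^esub>"
      if "\<xi> \<in> carrier (Hdual scale)" for \<xi>
      using that by (intro bexI[of _ "\<lambda>x. - \<xi> x"]) (auto simp: Hdual_carrier_iff)
  qed (auto simp: Hdual_carrier_iff algebra_simps)
  then show ?thesis
    by (intro left_module.intro left_module_axioms.intro)
      (auto simp: Hdual_carrier_iff distrib_right distrib_left scale_mult_left mult.assoc)
qed

lemma finprod_Hdual:
  assumes "finite F" "\<And>i. i \<in> F \<Longrightarrow> \<xi> i \<in> carrier (Hdual scale)"
  shows "finprod (Hdual scale) \<xi> F = (\<lambda>x. \<Sum>i\<in>F. \<xi> i x)"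
proof -
  interpret left_module "Hdual scale" by (rule left_module_Hdual)
  show ?thesis using assms by (induction F rule: finite_induct) (auto simp: Pi_iff)
qed

text \<open>\<open>f ((x * h) v) = f (x (h v))\<close>, which matches the action
  \<open>(h \<triangleright> \<xi>) x = \<xi> (x * h)\<close>. Each functional thus maps its object
  into the one module \<open>Hdual scale\<close>.\<close>

lemma coefficient_lhom:
  assumes "V \<in> C" "f \<in> St V"
  shows "(\<lambda>v h. f (h \<triangleright>\<^bsub>V\<^esub> v)) \<in> lhom V (Hdual scale)"
proof -
  interpret left_module V using module[OF assms(1)] .
  note f = functional_add[OF assms] functional_scale[OF assms]
  have "f (scale a h \<triangleright>\<^bsub>V\<^esub> v) = a * f (h \<triangleright>\<^bsub>V\<^esub> v)" if "v \<in> carrier V" for a h v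
    using f(2)[OF lact_closed[OF that], of a h] lact_mult[OF that, of "scale a 1" h]
    by (simp add: scale_one_mult)
  then show ?thesis
    by (intro lhomI) (simp_all add: Hdual_carrier_iff lact_add_left lact_add_right lact_mult f lact_closed)
qed

lemma lmodule_hom_coefficient:
  "V \<in> C \<Longrightarrow> f \<in> St V \<Longrightarrow> lmodule_hom V (Hdual scale) (\<lambda>v h. f (h \<triangleright>\<^bsub>V\<^esub> v))"
  by (intro lmodule_hom.intro lmodule_hom_axioms.intro module left_module_Hdual coefficient_lhom)

lemma lsubmodule_coeffs:
  assumes "D \<subseteq> C" shows "lsubmodule (coeffs St D) (Hdual scale)"
proof -
  interpret left_module "Hdual scale" by (rule left_module_Hdual)
  have "\<xi> \<in> carrier (Hdual scale)" if "\<xi> \<in> coeffs St D" for \<xi>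
    using that
  proof (induction rule: coeffs_induct)
    case (add V v f \<zeta>)
    then show ?case
      using m_closed[OF lhomD(1)[OF coefficient_lhom]] assms by (auto simp: subset_iff)
  qed (use one_closed in simp)
  moreover have "(\<lambda>x. \<xi> (x * h)) \<in> coeffs St D" if "\<xi> \<in> coeffs St D" for h \<xi>
    using that
  proof (induction rule: coeffs_induct)
    case (add V v f \<zeta>)
    then interpret V: left_module V using module assms by blast
    have "(\<lambda>x. f (x \<triangleright>\<^bsub>V\<^esub> (h \<triangleright>\<^bsub>V\<^esub> v))) \<in> coeffs St D"
      using add by (intro coeffs_single V.lact_closed)
    then show ?case
      using coeffs_add[OF _ add(4)] add(2) by (simp add: V.lact_mult)
  qed (rule coeffs_zero)
  ultimately show ?thesis
    by (intro lsubmoduleI) (auto intro: coeffs_zero coeffs_add)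
qed

lemma coeffs_carrier: "D \<subseteq> C \<Longrightarrow> \<xi> \<in> coeffs St D \<Longrightarrow> \<xi> \<in> carrier (Hdual scale)"
  using lsubmoduleD(2)[OF lsubmodule_coeffs] by blast

text \<open>Translation on this side moves the functional instead of the vector:
  \<open>f ((h * x) v) = (f \<triangleleft> h) (x v)\<close>.\<close>

lemma coeffs_bract:
  assumes "D \<subseteq> C" "\<xi> \<in> coeffs St D" shows "(\<lambda>x. \<xi> (h * x)) \<in> coeffs St D"
  using assms(2)
proof (induction rule: coeffs_induct)
  case (add V v f \<zeta>)
  then interpret V: left_module V using module assms by blast
  have "V \<in> C" using add(1) assms(1) by blast
  then have "(\<lambda>x. (\<lambda>v\<in>carrier V. f (h \<triangleright>\<^bsub>V\<^esub> v)) (x \<triangleright>\<^bsub>V\<^esub> v)) \<in> coeffs St D"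
    using add by (intro coeffs_single functional_ract)
  then show ?case
    using coeffs_add[OF _ add(4)] add(2) by (simp add: V.lact_mult V.lact_closed)
qed (rule coeffs_zero)

text \<open>Negation is translation by -1, so lists of coefficients can do without signs.\<close>

lemma coeffs_uminus:
  assumes "D \<subseteq> C" "\<xi> \<in> coeffs St D" shows "(\<lambda>x. - \<xi> x) \<in> coeffs St D"
proof -
  have "\<xi> \<in> carrier (Hdual scale)" using coeffs_carrier assms by blast
  then have "\<xi> (scale (- 1) x) = - 1 * \<xi> x" for x unfolding Hdual_carrier_iff by blast
  then show ?thesis using coeffs_bract[OF assms, of "- 1"] by simp
qed

text \<open>\<open>f (h (\<phi> v)) = (f o \<phi>) (h v)\<close>, and functoriality of the duality
  puts \<open>f o \<phi>\<close> into \<open>St V\<close>. A coefficient of the target of a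
  morphism, taken at a vector of the image, is thus one of the source.\<close>

lemma coefficient_transpose:
  assumes "V \<in> D" "D \<subseteq> C" "W \<in> C" "\<phi> \<in> lhom V W" "v \<in> carrier V" "f \<in> St W"
  shows "(\<lambda>h. f (h \<triangleright>\<^bsub>W\<^esub> \<phi> v)) \<in> coeffs St D"
proof -
  have V: "V \<in> C" using assms(1,2) by blast
  then interpret V: left_module V by (rule module)
  have "(\<lambda>h. compose (carrier V) f \<phi> (h \<triangleright>\<^bsub>V\<^esub> v)) \<in> coeffs St D"
    by (intro coeffs_single functional_transpose[of V W] assms V)
  moreover have "compose (carrier V) f \<phi> (h \<triangleright>\<^bsub>V\<^esub> v) = f (h \<triangleright>\<^bsub>W\<^esub> \<phi> v)" for h
    using assms(4,5) by (simp add: compose_def V.lact_closed lhomD(3))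
  ultimately show ?thesis by simp
qed

lemma coeffs_iso_subset:
  assumes "V \<in> C" "W \<in> C" "lisomorphic V W" shows "coeffs St {W} \<subseteq> coeffs St {V}"
proof
  fix \<xi> assume "\<xi> \<in> coeffs St {W}"
  obtain \<phi> where \<phi>: "\<phi> \<in> lhom V W" "bij_betw \<phi> (carrier V) (carrier W)"
    using assms(3) by (rule lisomorphicE)
  show "\<xi> \<in> coeffs St {V}"
    using \<open>\<xi> \<in> coeffs St {W}\<close>
  proof (induction rule: coeffs_induct)
    case (add U w f \<zeta>)
    then have U: "U = W" by simp
    have "w \<in> \<phi> ` carrier V" using \<phi>(2) add(2) by (simp add: U bij_betw_def)
    then obtain v where v: "v \<in> carrier V" "w = \<phi> v" by blast
    have "(\<lambda>h. f (h \<triangleright>\<^bsub>W\<^esub> \<phi> v)) \<in> coeffs St {V}"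
      by (rule coefficient_transpose[of V _ W]) (use assms \<phi>(1) v(1) add(3) U in auto)
    then show ?case using coeffs_add[OF _ add(4)] by (simp add: U v(2))
  qed (rule coeffs_zero)
qed

lemma coeffs_iso: "V \<in> C \<Longrightarrow> W \<in> C \<Longrightarrow> lisomorphic V W \<Longrightarrow> coeffs St {V} = coeffs St {W}"
  using coeffs_iso_subset lisomorphic_sym module by (metis subset_antisym)

end


section \<open>The spaces \<open>H\<^sup>*\<^sub>V\<close>\<close>

text \<open>Summing over a finite superset of the support allows two elements to be compared over a
  common index set.\<close>

lemma beta_free_superset:
  assumes "finite K" "Poly_Mapping.keys p \<subseteq> K"
  shows "beta_free V p h = (\<Sum>(v, f)\<in>K. of_int (Poly_Mapping.lookup p (v, f)) * f (h \<triangleright>\<^bsub>V\<^esub> v))"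
  unfolding beta_free_def using assms
  by (intro sum.mono_neutral_left) (auto simp: in_keys_iff)

lemma beta_free_diff: "beta_free V (p - q) = (\<lambda>h. beta_free V p h - beta_free V q h)"
proof
  fix h
  let ?K = "Poly_Mapping.keys p \<union> Poly_Mapping.keys q"
  have "beta_free V (p - q) h =
      (\<Sum>(v, f)\<in>?K. of_int (Poly_Mapping.lookup (p - q) (v, f)) * f (h \<triangleright>\<^bsub>V\<^esub> v))"
    by (intro beta_free_superset) (use keys_diff[of p q] in auto)
  also have "\<dots> = beta_free V p h - beta_free V q h"
    by (subst (1 2) beta_free_superset[of ?K])
      (auto simp: lookup_minus left_diff_distrib sum_subtractf case_prod_beta)
  finally show "beta_free V (p - q) h = beta_free V p h - beta_free V q h" .
qed

lemma beta_free_zero: "beta_free V 0 = (\<lambda>h. 0)"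
  by (simp add: beta_free_def fun_eq_iff)

lemma beta_free_add: "beta_free V (p + q) = (\<lambda>h. beta_free V p h + beta_free V q h)"
  using beta_free_diff[of V "p + q" q] by (simp add: fun_eq_iff)

lemma beta_free_of: "beta_free V (frag_of (v, f)) = (\<lambda>h. f (h \<triangleright>\<^bsub>V\<^esub> v))"
  by (simp add: beta_free_def fun_eq_iff)

context dual_category
begin

text \<open>The three kinds of generators go to zero because the action and \<open>f\<close> are
  additive, because functionals are added pointwise, and because \<open>d\<close> commutes with the
  action. For the third kind to lie in the free group on \<open>carrier V \<times> St V\<close>,
  transposes of endomorphisms must preserve \<open>St V\<close>.\<close>

lemma
  assumes "V \<in> C"
  shows subgroup_tensor_relations:
      "subgroup (tensor_relations scale V (St V)) (tensor_free V (St V))"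
    and beta_free_tensor_relations:
      "\<And>r. r \<in> tensor_relations scale V (St V) \<Longrightarrow> beta_free V r = (\<lambda>h. 0)"
proof -
  interpret left_module V using module[OF assms] .
  let ?S = "St V" and ?F = "tensor_free V (St V)"
  let ?G1 = "{frag_of (v \<otimes>\<^bsub>V\<^esub> w, f) - frag_of (v, f) - frag_of (w, f) | v w f.
        v \<in> carrier V \<and> w \<in> carrier V \<and> f \<in> ?S}"
  let ?G2 = "{frag_of (v, f \<otimes>\<^bsub>dual scale V\<^esub> g) - frag_of (v, f) - frag_of (v, g) | v f g.
        v \<in> carrier V \<and> f \<in> ?S \<and> g \<in> ?S}"
  let ?G3 = "{frag_of (d v, f) - frag_of (v, compose (carrier V) f d) | v f d.
        v \<in> carrier V \<and> f \<in> ?S \<and> d \<in> lhom V V}"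
  let ?G = "?G1 \<union> ?G2 \<union> ?G3"
  interpret F: group ?F by (simp add: tensor_free_def)
  have R: "tensor_relations scale V ?S = generate ?F ?G"
    by (simp add: tensor_relations_def Un_assoc)
  have in_F: "frag_of (v, f) \<in> carrier ?F" if "v \<in> carrier V" "f \<in> ?S" for v f
    using that by (simp add: tensor_free_def)
  have diff_F: "p - q \<in> carrier ?F" if "p \<in> carrier ?F" "q \<in> carrier ?F" for p q
    using that keys_diff[of p q] by (auto simp: tensor_free_def)
  have rsub: "rsubmodule ?S (dual scale V)"
    using duality assms by (simp add: finite_duality_functor_def)
  have "?G1 \<subseteq> carrier ?F" using in_F diff_F by auto
  moreover have "?G2 \<subseteq> carrier ?F"
    using rsub in_F by (auto intro!: diff_F simp: rsubmodule_def subgroup_def)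
  moreover have "?G3 \<subseteq> carrier ?F"
    using in_F functional_transpose[OF assms assms] by (auto intro!: diff_F lhomD(1))
  ultimately have G: "?G \<subseteq> carrier ?F" by (intro Un_least)
  then show sub: "subgroup (tensor_relations scale V ?S) ?F"
    unfolding R by (rule F.generate_is_subgroup)
  note f = functional_add[OF assms]
  have gen: "beta_free V r = (\<lambda>h. 0)" if "r \<in> ?G" for r
    using that
  proof (elim UnE)
    assume "r \<in> ?G1"
    then show ?thesis
      by (auto simp: beta_free_diff beta_free_of fun_eq_iff lact_add_right f lact_closed)
  next
    assume "r \<in> ?G2"
    then show ?thesis
      by (auto simp: beta_free_diff beta_free_of fun_eq_iff dual_def lact_closed)
  next
    assume "r \<in> ?G3"
    then show ?thesis
      by (auto simp: beta_free_diff beta_free_of fun_eq_iff compose_def lact_closed lhomD(3))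
  qed
  show "beta_free V r = (\<lambda>h. 0)" if "r \<in> tensor_relations scale V ?S" for r
    using that unfolding R
  proof (induction rule: generate.induct)
    case one
    then show ?case by (simp add: tensor_free_def beta_free_zero)
  next
    case (inv r)
    have "r \<in> carrier ?F" by (rule subsetD[OF G inv])
    \<comment> \<open>Written as a difference, the inverse is accessible to
      \<open>beta_free_diff\<close>; \<open>diff_0\<close> is removed below so that it stays in this
      form.\<close>
    then have "inv\<^bsub>?F\<^esub> r = 0 - r" by (simp add: tensor_free_def)
    then show ?case
      using gen[OF inv] by (simp add: beta_free_diff beta_free_zero del: diff_0)
  next
    case (eng p q)
    then show ?case by (simp add: tensor_free_def beta_free_add)
  qed (rule gen)
qed

text \<open>An element of the free group is an integer combination of generators, and its negative
  coefficients are absorbed by \<open>coeffs_uminus\<close>. This replaces tensors by lists of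
  coefficients.\<close>

lemma Hdual_obj_eq_coeffs:
  assumes "V \<in> C" shows "Hdual_obj scale St V = coeffs St {V}"
proof -
  let ?F = "tensor_free V (St V)" and ?R = "tensor_relations scale V (St V)"
  have "carrier (tensor scale V (St V)) = (\<lambda>p. ?R #>\<^bsub>?F\<^esub> p) ` carrier ?F"
    by (simp add: tensor_def Let_def bimodule_of_def carrier_FactGroup)
  \<comment> \<open>Relations go to zero, so \<open>beta_free\<close> maps a coset to a singleton
    and \<open>the_elem\<close> returns the common value.\<close>
  moreover have "beta V (?R #>\<^bsub>?F\<^esub> p) = beta_free V p" for p
  proof -
    have "0 \<in> ?R"
      using subgroup.one_closed[OF subgroup_tensor_relations[OF assms]] by (simp add: tensor_free_def)
    moreover have "beta_free V (r + p) = beta_free V p" if "r \<in> ?R" for r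
      using beta_free_tensor_relations[OF assms that] by (simp add: beta_free_add)
    ultimately have "beta_free V ` (\<lambda>r. r + p) ` ?R = {beta_free V p}" by force
    moreover have "?R #>\<^bsub>?F\<^esub> p = (\<lambda>r. r + p) ` ?R"
      by (auto simp: r_coset_def tensor_free_def)
    ultimately show ?thesis by (simp add: beta_def)
  qed
  ultimately have obj: "Hdual_obj scale St V = beta_free V ` carrier ?F"
    by (simp add: Hdual_obj_def image_image)
  show ?thesis
  proof
    show "Hdual_obj scale St V \<subseteq> coeffs St {V}"
    proof -
      have "beta_free V p \<in> coeffs St {V}" if "Poly_Mapping.keys p \<subseteq> carrier V \<times> St V" for p
        using that
      proof (rule free_Abelian_group_induct)
        show "beta_free V 0 \<in> coeffs St {V}" by (simp add: beta_free_zero coeffs_zero)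
        show "beta_free V (p - q) \<in> coeffs St {V}"
          if "beta_free V p \<in> coeffs St {V}" "beta_free V q \<in> coeffs St {V}" for p q
          using coeffs_add[OF that(1) coeffs_uminus[OF _ that(2)]] assms by (simp add: beta_free_diff)
        show "beta_free V (frag_of a) \<in> coeffs St {V}" if "a \<in> carrier V \<times> St V" for a
          using that by (cases a) (auto simp: beta_free_of intro: coeffs_single)
      qed
      then show ?thesis by (auto simp: obj tensor_free_def)
    qed
    show "coeffs St {V} \<subseteq> Hdual_obj scale St V"
    proof
      fix \<xi> assume "\<xi> \<in> coeffs St {V}"
      then show "\<xi> \<in> Hdual_obj scale St V"
      proof (induction rule: coeffs_induct)
        case zero
        have "0 \<in> carrier ?F" by (simp add: tensor_free_def)
        then show ?case unfolding obj by (rule image_eqI[rotated]) (simp add: beta_free_zero)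
      next
        case (add U v f \<zeta>)
        then obtain p where p: "p \<in> carrier ?F" "\<zeta> = beta_free V p" by (auto simp: obj)
        have "frag_of (v, f) + p \<in> carrier ?F"
          using add p(1) keys_add[of "frag_of (v, f)" p] by (auto simp: tensor_free_def)
        then show ?case
          unfolding obj
          by (rule image_eqI[rotated]) (use add p(2) in \<open>simp add: beta_free_add beta_free_of\<close>)
      qed
    qed
  qed
qed

section \<open>Isomorphism classes and their representatives\<close>

definition representative :: "('h, 'v) lmodule set \<Rightarrow> ('h, 'v) lmodule"
  where "representative X = (SOME V. V \<in> X)"

lemma equiv_iso_rel: "equiv C (iso_rel C)"
proof (rule equivI)
  show "sym (iso_rel C)"
    using lisomorphic_sym module by (auto simp: sym_def iso_rel_def)
  show "trans (iso_rel C)"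
    using lisomorphic_trans by (auto simp: trans_def iso_rel_def)
qed (auto simp: refl_on_def iso_rel_def lisomorphic_refl)

lemma Iso_representative:
  assumes "X \<in> Iso C" shows "representative X \<in> C" "X = iso_rel C `` {representative X}"
proof -
  obtain V where V: "V \<in> C" "X = iso_rel C `` {V}"
    using assms by (auto simp: Iso_def elim: quotientE)
  have "representative X \<in> X"
    unfolding representative_def
    by (rule someI[of _ V]) (use V lisomorphic_refl in \<open>auto simp: iso_rel_def\<close>)
  then have *: "(V, representative X) \<in> iso_rel C" using V(2) by simp
  then show "representative X \<in> C" by (simp add: iso_rel_def)
  show "X = iso_rel C `` {representative X}"
    using equiv_class_eq[OF equiv_iso_rel *] V(2) by simp
qed

lemma Iso_simple_subset: "Iso_simple C \<subseteq> Iso C"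
  by (auto simp: Iso_simple_def Iso_def simple_objects_def quotient_def)

text \<open>The classes are taken under \<open>iso_rel C\<close>, a relation on all of
  \<open>C\<close>, so simplicity has to be carried along an isomorphism to the chosen
  element.\<close>

lemma Iso_simple_representative:
  assumes "X \<in> Iso_simple C" shows "representative X \<in> simple_objects C"
proof -
  have X: "X \<in> Iso C" using assms Iso_simple_subset by blast
  obtain V where V: "V \<in> simple_objects C" "X = iso_rel C `` {V}"
    using assms by (auto simp: Iso_simple_def elim: quotientE)
  have "V \<in> X" using V lisomorphic_refl by (auto simp: iso_rel_def simple_objects_def)
  then have "lisomorphic (representative X) V" "V \<in> C"
    using Iso_representative(2)[OF X] by (auto simp: iso_rel_def)
  then have "lisomorphic V (representative X)"
    using lisomorphic_sym module Iso_representative(1)[OF X] by blast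
  then show ?thesis
    using simple_lmodule_iso[of V "representative X"] V(1) module Iso_representative(1)[OF X]
    by (auto simp: simple_objects_def)
qed

lemma Iso_representative_nonisomorphic:
  assumes "X \<in> Iso C" "Y \<in> Iso C" "X \<noteq> Y"
  shows "\<not> lisomorphic (representative X) (representative Y)"
proof
  assume "lisomorphic (representative X) (representative Y)"
  then have "(representative X, representative Y) \<in> iso_rel C"
    using Iso_representative(1) assms by (auto simp: iso_rel_def)
  from equiv_class_eq[OF equiv_iso_rel this] show False
    using Iso_representative(2) assms by metis
qed

lemma Hdual_class_eq_coeffs:
  "X \<in> Iso C \<Longrightarrow> Hdual_class scale St X = coeffs St {representative X}"
  using Hdual_obj_eq_coeffs[OF Iso_representative(1)] by (simp add: Hdual_class_def representative_def)

lemma coeffs_eq_Hdual_class: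
  assumes "V \<in> C"
  shows "iso_rel C `` {V} \<in> Iso C" "coeffs St {V} = Hdual_class scale St (iso_rel C `` {V})"
proof -
  show X: "iso_rel C `` {V} \<in> Iso C" using assms by (auto simp: Iso_def intro: quotientI)
  have "V \<in> iso_rel C `` {V}" using assms lisomorphic_refl by (auto simp: iso_rel_def)
  then have "lisomorphic (representative (iso_rel C `` {V})) V"
    using Iso_representative(2)[OF X] by (auto simp: iso_rel_def)
  then show "coeffs St {V} = Hdual_class scale St (iso_rel C `` {V})"
    using coeffs_iso[OF Iso_representative(1)[OF X] assms] Hdual_class_eq_coeffs[OF X] by simp
qed

lemma Hdual_class_subset_coeffs:
  "X \<in> Iso C \<Longrightarrow> representative X \<in> D \<Longrightarrow> Hdual_class scale St X \<subseteq> coeffs St D"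
  using coeffs_mono[of "{representative X}" D St] by (simp add: Hdual_class_eq_coeffs)

lemma Hdual_sum_eq:
  "carrier (Hdual_sum scale C St) = {finprod (Hdual scale) \<xi> F | \<xi> F.
      finite F \<and> F \<subseteq> Iso C \<and> (\<forall>X\<in>F. \<xi> X \<in> Hdual_class scale St X)}"
  by (simp add: Hdual_sum_def)

lemma Hdual_sum_subset_coeffs: "carrier (Hdual_sum scale C St) \<subseteq> coeffs St C"
proof
  fix \<eta> assume "\<eta> \<in> carrier (Hdual_sum scale C St)"
  then obtain \<xi> F where F: "finite F" "F \<subseteq> Iso C" "\<forall>X\<in>F. \<xi> X \<in> Hdual_class scale St X"
    and \<eta>: "\<eta> = finprod (Hdual scale) \<xi> F" unfolding Hdual_sum_eq by blast
  have \<xi>: "\<xi> X \<in> coeffs St C" if "X \<in> F" for X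
    using that F Hdual_class_subset_coeffs Iso_representative(1) by blast
  have "\<eta> = (\<lambda>x. \<Sum>X\<in>F. \<xi> X x)"
    unfolding \<eta> using F(1) coeffs_carrier[OF subset_refl \<xi>] by (rule finprod_Hdual)
  then show "\<eta> \<in> coeffs St C" using coeffs_sum[OF F(1) \<xi>] by simp
qed

text \<open>It is a sum with one term, indexed by the class of \<open>V\<close>; by isomorphism
  invariance the term lies in the space of the chosen representative.\<close>

lemma coefficient_in_Hdual_sum:
  assumes "V \<in> C" "v \<in> carrier V" "f \<in> St V"
  shows "(\<lambda>h. f (h \<triangleright>\<^bsub>V\<^esub> v)) \<in> carrier (Hdual_sum scale C St)"
proof -
  let ?\<eta> = "\<lambda>h. f (h \<triangleright>\<^bsub>V\<^esub> v)" and ?X = "iso_rel C `` {V}"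
  have \<eta>: "?\<eta> \<in> coeffs St {V}" using assms by (intro coeffs_single) auto
  then have "?\<eta> \<in> carrier (Hdual scale)" using coeffs_carrier[of "{V}"] assms(1) by blast
  then have "?\<eta> = finprod (Hdual scale) (\<lambda>_. ?\<eta>) {?X}" by (subst finprod_Hdual) auto
  moreover have "finite {?X}" "{?X} \<subseteq> Iso C" "\<forall>X\<in>{?X}. ?\<eta> \<in> Hdual_class scale St X"
    using \<eta> coeffs_eq_Hdual_class[OF assms(1)] by simp_all
  ultimately show ?thesis unfolding Hdual_sum_eq by (intro CollectI exI conjI)
qed

end


section \<open>The natural homomorphism\<close>

context dual_category
begin

lemma Hdual_sum_simps [simp]:
  "\<xi> \<otimes>\<^bsub>Hdual_sum scale C St\<^esub> \<zeta> = (\<lambda>x. \<xi> x + \<zeta> x)"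
  "h \<triangleright>\<^bsub>Hdual_sum scale C St\<^esub> \<xi> = (\<lambda>x. \<xi> (x * h))"
  "bract (Hdual_sum scale C St) \<xi> h = (\<lambda>x. \<xi> (h * x))"
  by (simp_all add: Hdual_sum_def Hdual_def)

lemma Hdual_simple_sum_simps [simp]:
  "\<xi> \<otimes>\<^bsub>Hdual_simple_sum scale C St\<^esub> \<zeta> = (\<lambda>X\<in>Iso_simple C. \<lambda>x. \<xi> X x + \<zeta> X x)"
  "h \<triangleright>\<^bsub>Hdual_simple_sum scale C St\<^esub> \<xi> = (\<lambda>X\<in>Iso_simple C. \<lambda>x. \<xi> X (x * h))"
  "bract (Hdual_simple_sum scale C St) \<xi> h = (\<lambda>X\<in>Iso_simple C. \<lambda>x. \<xi> X (h * x))"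
  by (simp_all add: Hdual_simple_sum_def bdirect_sum_def bimodule_of_def Hdual_def)

lemma lsubmodule_Hdual_class:
  assumes "X \<in> Iso C" shows "lsubmodule (Hdual_class scale St X) (Hdual scale)"
  unfolding Hdual_class_eq_coeffs[OF assms]
  by (rule lsubmodule_coeffs) (use Iso_representative(1)[OF assms] in simp)

lemma Hdual_simple_sum_carrier:
  "carrier (Hdual_simple_sum scale C St) =
    {\<xi> \<in> (\<Pi>\<^sub>E X\<in>Iso_simple C. Hdual_class scale St X). finite {X \<in> Iso_simple C. \<xi> X \<noteq> (\<lambda>x. 0)}}"
proof -
  have "group (Hdual scale\<lparr>carrier := Hdual_class scale St X\<rparr>)" if "X \<in> Iso_simple C" for X
  proof -
    have "X \<in> Iso C" using that Iso_simple_subset by blast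
    from left_module.left_module_restrict[OF left_module_Hdual lsubmodule_Hdual_class[OF this]]
    show ?thesis by (simp add: left_module_def comm_group_def)
  qed
  then show ?thesis
    by (simp add: Hdual_simple_sum_def bdirect_sum_def bimodule_of_def carrier_sum_group)
qed

lemma Hdual_simple_sumD:
  assumes "\<xi> \<in> carrier (Hdual_simple_sum scale C St)" "X \<in> Iso_simple C"
  shows "\<xi> X \<in> Hdual_class scale St X" "\<xi> X \<in> coeffs St {representative X}"
    "\<xi> X \<in> carrier (Hdual scale)"
proof -
  have X: "X \<in> Iso C" using assms(2) Iso_simple_subset by blast
  show *: "\<xi> X \<in> Hdual_class scale St X" using assms by (auto simp: Hdual_simple_sum_carrier)
  then show "\<xi> X \<in> coeffs St {representative X}" using Hdual_class_eq_coeffs[OF X] by simp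
  show "\<xi> X \<in> carrier (Hdual scale)"
    using * lsubmoduleD(2)[OF lsubmodule_Hdual_class[OF X]] by blast
qed

text \<open>\<open>gfinprod\<close> runs over the support of \<open>\<xi>\<close>. Allowing any
  finite \<open>F\<close> that contains the support lets two families be summed over the same
  set.\<close>

lemma natural_map_eq:
  assumes "finite F" "F \<subseteq> Iso_simple C" "\<forall>X\<in>Iso_simple C - F. \<xi> X = (\<lambda>x. 0)"
    and "\<And>X. X \<in> F \<Longrightarrow> \<xi> X \<in> carrier (Hdual scale)"
  shows "natural_map scale C \<xi> = (\<lambda>x. \<Sum>X\<in>F. \<xi> X x)"
proof -
  let ?K = "{X \<in> Iso_simple C. \<xi> X \<noteq> (\<lambda>x. 0)}"
  have K: "?K \<subseteq> F" using assms(3) by blast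
  then have fin: "finite ?K" using assms(1) by (rule finite_subset)
  then have "natural_map scale C \<xi> = finprod (Hdual scale) \<xi> ?K"
    by (simp add: natural_map_def gfinprod_def)
  also have "\<dots> = (\<lambda>x. \<Sum>X\<in>?K. \<xi> X x)"
    by (rule finprod_Hdual[OF fin]) (use K assms(4) in blast)
  also have "\<dots> = (\<lambda>x. \<Sum>X\<in>F. \<xi> X x)"
  proof
    show "(\<Sum>X\<in>?K. \<xi> X x) = (\<Sum>X\<in>F. \<xi> X x)" for x
      by (rule sum.mono_neutral_left[OF assms(1) K]) (use assms(2) in auto)
  qed
  finally show ?thesis .
qed

lemma natural_map_support:
  assumes "\<xi> \<in> carrier (Hdual_simple_sum scale C St)"
  obtains F where "finite F" "F \<subseteq> Iso_simple C"
    "\<forall>X\<in>Iso_simple C - F. \<xi> X = (\<lambda>x. 0)"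
proof (rule that)
  show "finite {X \<in> Iso_simple C. \<xi> X \<noteq> (\<lambda>x. 0)}" using assms by (simp add: Hdual_simple_sum_carrier)
qed auto

lemma natural_map_in_Hdual_sum:
  assumes "\<xi> \<in> carrier (Hdual_simple_sum scale C St)"
  shows "natural_map scale C \<xi> \<in> carrier (Hdual_sum scale C St)"
proof -
  obtain F where F: "finite F" "F \<subseteq> Iso_simple C"
    "\<forall>X\<in>Iso_simple C - F. \<xi> X = (\<lambda>x. 0)"
    using assms by (rule natural_map_support)
  have \<xi>: "\<xi> X \<in> carrier (Hdual scale)" "\<xi> X \<in> Hdual_class scale St X" if "X \<in> F" for X
    using Hdual_simple_sumD[OF assms] F(2) that by blast+
  have "natural_map scale C \<xi> = finprod (Hdual scale) \<xi> F"
    using natural_map_eq[OF F \<xi>(1)] finprod_Hdual[OF F(1) \<xi>(1)] by simp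
  moreover have "F \<subseteq> Iso C" using F(2) Iso_simple_subset by blast
  ultimately show ?thesis
    unfolding Hdual_sum_eq using F(1) \<xi>(2) by (intro CollectI exI conjI ballI)
qed

lemma natural_map_in_coeffs:
  assumes "\<xi> \<in> carrier (Hdual_simple_sum scale C St)"
  shows "natural_map scale C \<xi> \<in> coeffs St (simple_objects C)"
proof -
  obtain F where F: "finite F" "F \<subseteq> Iso_simple C"
    "\<forall>X\<in>Iso_simple C - F. \<xi> X = (\<lambda>x. 0)"
    using assms by (rule natural_map_support)
  have \<xi>: "\<xi> X \<in> carrier (Hdual scale)" "\<xi> X \<in> coeffs St (simple_objects C)" if "X \<in> F" for X
  proof -
    have X: "X \<in> Iso_simple C" using F(2) that by blast
    show "\<xi> X \<in> carrier (Hdual scale)" by (rule Hdual_simple_sumD[OF assms X])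
    show "\<xi> X \<in> coeffs St (simple_objects C)"
      using Hdual_simple_sumD(2)[OF assms X] Iso_simple_representative[OF X]
        coeffs_mono[of "{representative X}" "simple_objects C" St] by blast
  qed
  have "natural_map scale C \<xi> = (\<lambda>x. \<Sum>X\<in>F. \<xi> X x)"
    by (rule natural_map_eq[OF F \<xi>(1)])
  also have "\<dots> \<in> coeffs St (simple_objects C)"
    by (rule coeffs_sum[OF F(1) \<xi>(2)])
  finally show ?thesis .
qed

text \<open>Induction on the list of coefficients: a coefficient of a simple \<open>V\<close> is
  added to the component at the class of \<open>V\<close>.\<close>

lemma natural_map_onto_coeffs:
  assumes "\<eta> \<in> coeffs St (simple_objects C)"
  shows "\<eta> \<in> natural_map scale C ` carrier (Hdual_simple_sum scale C St)"
  using assms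
proof (induction rule: coeffs_induct)
  case zero
  let ?\<xi> = "\<lambda>X\<in>Iso_simple C. \<lambda>x. 0"
  have "natural_map scale C ?\<xi> = (\<lambda>x. 0)"
    using natural_map_eq[of "{}" ?\<xi>] by simp
  moreover have "?\<xi> \<in> carrier (Hdual_simple_sum scale C St)"
    using lsubmoduleD(3)[OF lsubmodule_Hdual_class] Iso_simple_subset
    by (auto simp: Hdual_simple_sum_carrier)
  ultimately show ?case by (metis imageI)
next
  case (add V v f \<zeta>)
  define g where "g = (\<lambda>h. f (h \<triangleright>\<^bsub>V\<^esub> v))"
  define X where "X = iso_rel C `` {V}"
  have V: "V \<in> C" using add(1) by (simp add: simple_objects_def)
  have X: "X \<in> Iso_simple C" unfolding X_def Iso_simple_def using add(1) by (rule quotientI)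
  have g: "g \<in> Hdual_class scale St X"
    unfolding X_def g_def coeffs_eq_Hdual_class(2)[OF V, symmetric]
    using add by (intro coeffs_single) auto
  obtain \<xi> where \<xi>: "\<xi> \<in> carrier (Hdual_simple_sum scale C St)" "\<zeta> = natural_map scale C \<xi>"
    using add(4) by blast
  obtain F where F: "finite F" "F \<subseteq> Iso_simple C" "\<forall>Y\<in>Iso_simple C - F. \<xi> Y = (\<lambda>x. 0)"
    using \<xi>(1) by (rule natural_map_support)
  define \<xi>' where "\<xi>' = \<xi>(X := \<lambda>h. g h + \<xi> X h)"
  have "\<xi>' Y \<in> Hdual_class scale St Y" if "Y \<in> Iso_simple C" for Y
    using lsubmoduleD(4)[OF lsubmodule_Hdual_class g Hdual_simple_sumD(1)[OF \<xi>(1) X]]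
      Hdual_simple_sumD(1)[OF \<xi>(1) that] X Iso_simple_subset by (auto simp: \<xi>'_def)
  moreover have "\<xi>' \<in> extensional (Iso_simple C)"
    using \<xi>(1) X by (auto simp: \<xi>'_def Hdual_simple_sum_carrier PiE_def extensional_def)
  moreover have "finite {Y \<in> Iso_simple C. \<xi>' Y \<noteq> (\<lambda>x. 0)}"
    by (rule finite_subset[of _ "insert X F"]) (use F in \<open>auto simp: \<xi>'_def\<close>)
  ultimately have \<xi>': "\<xi>' \<in> carrier (Hdual_simple_sum scale C St)"
    by (simp add: Hdual_simple_sum_carrier PiE_iff)
  \<comment> \<open>\<open>X\<close> may or may not lie in \<open>F\<close>; summing both families
    over \<open>insert X F\<close> treats the two cases at once.\<close>
  have ins: "finite (insert X F)" "insert X F \<subseteq> Iso_simple C" using F X by auto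
  have "natural_map scale C \<xi>' = (\<lambda>x. \<Sum>Y\<in>insert X F. \<xi>' Y x)"
  proof (rule natural_map_eq[OF ins])
    show "\<forall>Y\<in>Iso_simple C - insert X F. \<xi>' Y = (\<lambda>x. 0)" using F(3) by (simp add: \<xi>'_def)
    show "\<xi>' Y \<in> carrier (Hdual scale)" if "Y \<in> insert X F" for Y
      by (rule Hdual_simple_sumD(3)[OF \<xi>']) (use ins(2) that in blast)
  qed
  also have "\<dots> = (\<lambda>x. g x + (\<Sum>Y\<in>insert X F. \<xi> Y x))"
    using F(1) by (auto simp: \<xi>'_def fun_eq_iff sum.insert_remove add.assoc intro!: sum.cong)
  also have "\<dots> = (\<lambda>x. g x + \<zeta> x)"
  proof -
    have "\<zeta> = (\<lambda>x. \<Sum>Y\<in>insert X F. \<xi> Y x)"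
      unfolding \<xi>(2)
    proof (rule natural_map_eq[OF ins])
      show "\<forall>Y\<in>Iso_simple C - insert X F. \<xi> Y = (\<lambda>x. 0)" using F(3) by simp
      show "\<xi> Y \<in> carrier (Hdual scale)" if "Y \<in> insert X F" for Y
        by (rule Hdual_simple_sumD(3)[OF \<xi>(1)]) (use ins(2) that in blast)
    qed
    then show ?thesis by (simp add: fun_eq_iff)
  qed
  finally show ?case using imageI[OF \<xi>', of "natural_map scale C"] by (simp add: g_def)
qed

text \<open>Right translation by an element that fixes the vectors occurring in \<open>\<xi> X\<^sub>0\<close> and kills
  those in the other components isolates \<open>\<xi> X\<^sub>0\<close> from the sum of the components.\<close>

lemma natural_map_inj: "inj_on (natural_map scale C) (carrier (Hdual_simple_sum scale C St))"
proof (rule inj_onI)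
  let ?S = "carrier (Hdual_simple_sum scale C St)"
  fix \<xi> \<zeta> assume \<xi>: "\<xi> \<in> ?S" and \<zeta>: "\<zeta> \<in> ?S"
    and eq: "natural_map scale C \<xi> = natural_map scale C \<zeta>"
  obtain F where F: "finite F" "F \<subseteq> Iso_simple C"
    "\<forall>X\<in>Iso_simple C - F. \<xi> X = (\<lambda>x. 0)"
    using \<xi> by (rule natural_map_support)
  obtain G where G: "finite G" "G \<subseteq> Iso_simple C"
    "\<forall>X\<in>Iso_simple C - G. \<zeta> X = (\<lambda>x. 0)"
    using \<zeta> by (rule natural_map_support)
  let ?K = "F \<union> G"
  have K: "finite ?K" "?K \<subseteq> Iso_simple C" using F G by auto
  have "natural_map scale C \<xi> = (\<lambda>x. \<Sum>X\<in>?K. \<xi> X x)" "natural_map scale C \<zeta> = (\<lambda>x. \<Sum>X\<in>?K. \<zeta> X x)"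
    by (rule natural_map_eq[OF K]; use F G K Hdual_simple_sumD(3)[OF \<xi>] Hdual_simple_sumD(3)[OF \<zeta>] in blast)+
  then have sums: "(\<Sum>X\<in>?K. \<xi> X x) = (\<Sum>X\<in>?K. \<zeta> X x)" for x
    using eq by metis
  have "\<forall>X\<in>Iso_simple C. \<exists>ps. ps \<in> lists (coeff_data St {representative X}) \<and> \<xi> X = coeff_sum ps"
    "\<forall>X\<in>Iso_simple C. \<exists>ps. ps \<in> lists (coeff_data St {representative X}) \<and> \<zeta> X = coeff_sum ps"
    using Hdual_simple_sumD(2)[OF \<xi>] Hdual_simple_sumD(2)[OF \<zeta>] unfolding coeffs_def by blast+
  then obtain p q
    where p: "\<And>X. X \<in> Iso_simple C \<Longrightarrow> p X \<in> lists (coeff_data St {representative X}) \<and> \<xi> X = coeff_sum (p X)"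
      and q: "\<And>X. X \<in> Iso_simple C \<Longrightarrow> q X \<in> lists (coeff_data St {representative X}) \<and> \<zeta> X = coeff_sum (q X)"
    by metis
  \<comment> \<open>Both families contribute their vectors, so that one element of \<open>H\<close>
    serves for \<open>\<xi>\<close> and for \<open>\<zeta>\<close>.\<close>
  define vectors where "vectors X = (fst \<circ> snd) ` (set (p X) \<union> set (q X))" for X
  have vectors: "finite (vectors X)" "X \<in> Iso_simple C \<Longrightarrow> vectors X \<subseteq> carrier (representative X)" for X
    using p[of X] q[of X] by (auto simp: vectors_def coeff_data_def)
  have eq_on_K: "\<xi> X0 = \<zeta> X0" if X0: "X0 \<in> ?K" for X0
  proof -
    have rep: "left_module (representative X)" "simple_lmodule (representative X)" "X \<in> Iso C"
      if "X \<in> ?K" for X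
      using Iso_simple_representative[of X] that K(2) Iso_simple_subset module
      by (auto simp: simple_objects_def)
    \<comment> \<open>These are the vectors to be killed. Distinct classes have non-isomorphic
      representatives, as \<open>separating_element\<close> requires.\<close>
    define P where "P = (\<Union>X\<in>?K - {X0}. Pair (representative X) ` vectors X)"
    have "\<exists>a\<in>annihilator P. \<forall>w\<in>vectors X0. a \<triangleright>\<^bsub>representative X0\<^esub> w = w"
    proof (rule separating_element[OF rep(1,2)[OF X0]])
      show "finite P" unfolding P_def using K(1) vectors(1) by blast
      show "elements_of_modules P"
        unfolding elements_of_modules_def P_def using rep(1) vectors(2) K(2) by blast
      show "simple_lmodule V \<and> \<not> lisomorphic V (representative X0)" if "(V, v) \<in> P" for V v
        using that rep(2,3) X0 Iso_representative_nonisomorphic[OF rep(3) rep(3)[OF X0]]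
        unfolding P_def by blast
      show "vectors X0 \<subseteq> carrier (representative X0)" using vectors(2) X0 K(2) by blast
    qed (rule vectors(1))
    then obtain a where a: "a \<in> annihilator P"
      and a_fix: "\<And>w. w \<in> vectors X0 \<Longrightarrow> a \<triangleright>\<^bsub>representative X0\<^esub> w = w" by blast
    \<comment> \<open>The list is kept arbitrary, with vectors in \<open>vectors X\<close>, so that
      the induction also covers its tails.\<close>
    have translate: "coeff_sum ps (x * a) = (if X = X0 then coeff_sum ps x else 0)"
      if X: "X \<in> ?K" and ps: "ps \<in> lists (coeff_data St {representative X})"
        and vec: "(fst \<circ> snd) ` set ps \<subseteq> vectors X" for X ps x
      using ps vec
    proof (induction ps)
      case Nil
      then show ?case by (simp add: coeff_sum_Nil)
    next
      case (Cons t ps)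
      obtain v f where t: "t = (representative X, v, f)"
        and v: "v \<in> carrier (representative X)" and f: "f \<in> St (representative X)"
        using Cons.hyps by (auto simp: coeff_data_def)
      interpret R: left_module "representative X" by (rule rep(1)[OF X])
      have vX: "v \<in> vectors X" using Cons.prems by (simp add: t)
      have act: "(x * a) \<triangleright>\<^bsub>representative X\<^esub> v =
          x \<triangleright>\<^bsub>representative X\<^esub> (a \<triangleright>\<^bsub>representative X\<^esub> v)"
        by (rule R.lact_mult[OF v])
      have "f ((x * a) \<triangleright>\<^bsub>representative X\<^esub> v) = (if X = X0 then f (x \<triangleright>\<^bsub>representative X\<^esub> v) else 0)"
      proof (cases "X = X0")
        case True
        then show ?thesis using a_fix[of v] vX act by simp
      next
        case False
        then have "(representative X, v) \<in> P" unfolding P_def using X vX by blast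
        then have "a \<triangleright>\<^bsub>representative X\<^esub> v = \<one>\<^bsub>representative X\<^esub>"
          using a by (auto simp: annihilator_def)
        then show ?thesis
          using False functional_one[OF Iso_representative(1)[OF rep(3)[OF X]] f] act by simp
      qed
      then show ?case using Cons by (simp add: t coeff_sum_Cons)
    qed
    have tr: "\<xi> X (x * a) = (if X = X0 then \<xi> X x else 0)" "\<zeta> X (x * a) = (if X = X0 then \<zeta> X x else 0)"
      if X: "X \<in> ?K" for X x
    proof -
      have "X \<in> Iso_simple C" using X K(2) by blast
      note pX = p[OF this] and qX = q[OF this]
      have "(fst \<circ> snd) ` set (p X) \<subseteq> vectors X" "(fst \<circ> snd) ` set (q X) \<subseteq> vectors X"
        unfolding vectors_def by (intro image_mono Un_upper1 Un_upper2)+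
      note * = translate[OF X conjunct1[OF pX] this(1), of x] translate[OF X conjunct1[OF qX] this(2), of x]
      show "\<xi> X (x * a) = (if X = X0 then \<xi> X x else 0)" using *(1) by (simp only: conjunct2[OF pX])
      show "\<zeta> X (x * a) = (if X = X0 then \<zeta> X x else 0)" using *(2) by (simp only: conjunct2[OF qX])
    qed
    show ?thesis
    proof
      fix x
      have "(\<Sum>X\<in>?K. \<xi> X (x * a)) = \<xi> X0 x" "(\<Sum>X\<in>?K. \<zeta> X (x * a)) = \<zeta> X0 x"
        using K(1) X0 by (simp_all add: tr)
      then show "\<xi> X0 x = \<zeta> X0 x" using sums[of "x * a"] by simp
    qed
  qed
  show "\<xi> = \<zeta>"
  proof (rule PiE_ext)
    show "\<xi> \<in> (\<Pi>\<^sub>E X\<in>Iso_simple C. Hdual_class scale St X)"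
      "\<zeta> \<in> (\<Pi>\<^sub>E X\<in>Iso_simple C. Hdual_class scale St X)"
      using \<xi> \<zeta> by (simp_all add: Hdual_simple_sum_carrier)
    show "\<xi> X = \<zeta> X" if "X \<in> Iso_simple C" for X
      using eq_on_K[of X] F(3) G(3) that by (cases "X \<in> ?K") auto
  qed
qed

text \<open>The hypothesis supplies surjectivity: \<open>Hdual_sum\<close> lies in
  \<open>coeffs St C\<close>, and the natural map reaches all coefficients of simple
  objects.\<close>

lemma natural_map_bimodule_iso:
  assumes "coeffs St C \<subseteq> coeffs St (simple_objects C)"
  shows "natural_map scale C \<in> bimodule_iso (Hdual_simple_sum scale C St) (Hdual_sum scale C St)"
proof -
  let ?S = "Hdual_simple_sum scale C St" and ?T = "Hdual_sum scale C St" and ?n = "natural_map scale C"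
  \<comment> \<open>Both actions merely substitute \<open>x * h\<close> or \<open>h * x\<close> for
    the argument, so one statement about a substitution \<open>r\<close> serves for the two.\<close>
  have linear: "?n (\<lambda>X\<in>Iso_simple C. \<lambda>x. \<xi> X (r x)) = (\<lambda>x. ?n \<xi> (r x))"
    if \<xi>: "\<xi> \<in> carrier ?S" and r: "\<And>\<eta>. \<eta> \<in> carrier (Hdual scale) \<Longrightarrow> (\<lambda>x. \<eta> (r x)) \<in> carrier (Hdual scale)" for \<xi> r
  proof -
    obtain F where F: "finite F" "F \<subseteq> Iso_simple C" "\<forall>X\<in>Iso_simple C - F. \<xi> X = (\<lambda>x. 0)"
      using \<xi> by (rule natural_map_support)
    have \<xi>F: "\<xi> X \<in> carrier (Hdual scale)" if "X \<in> F" for X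
      by (rule Hdual_simple_sumD(3)[OF \<xi>]) (use F(2) that in blast)
    have "?n (\<lambda>X\<in>Iso_simple C. \<lambda>x. \<xi> X (r x)) = (\<lambda>x. \<Sum>X\<in>F. (\<lambda>X\<in>Iso_simple C. \<lambda>x. \<xi> X (r x)) X x)"
    proof (rule natural_map_eq[OF F(1,2)])
      show "\<forall>X\<in>Iso_simple C - F. (\<lambda>X\<in>Iso_simple C. \<lambda>x. \<xi> X (r x)) X = (\<lambda>x. 0)"
        using F(3) by simp
      show "(\<lambda>X\<in>Iso_simple C. \<lambda>x. \<xi> X (r x)) X \<in> carrier (Hdual scale)" if "X \<in> F" for X
        using r[OF \<xi>F[OF that]] that F(2) by auto
    qed
    also have "\<dots> = (\<lambda>x. \<Sum>X\<in>F. \<xi> X (r x))"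
      using F(2) by (auto simp: fun_eq_iff intro!: sum.cong)
    also have "\<dots> = (\<lambda>x. ?n \<xi> (r x))"
      using natural_map_eq[OF F \<xi>F] by simp
    finally show ?thesis .
  qed
  have add: "?n (\<lambda>X\<in>Iso_simple C. \<lambda>x. \<xi> X x + \<zeta> X x) = (\<lambda>x. ?n \<xi> x + ?n \<zeta> x)"
    if \<xi>: "\<xi> \<in> carrier ?S" and \<zeta>: "\<zeta> \<in> carrier ?S" for \<xi> \<zeta>
  proof -
    obtain F where F: "finite F" "F \<subseteq> Iso_simple C" "\<forall>X\<in>Iso_simple C - F. \<xi> X = (\<lambda>x. 0)"
      using \<xi> by (rule natural_map_support)
    obtain G where G: "finite G" "G \<subseteq> Iso_simple C" "\<forall>X\<in>Iso_simple C - G. \<zeta> X = (\<lambda>x. 0)"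
      using \<zeta> by (rule natural_map_support)
    let ?K = "F \<union> G"
    have K: "finite ?K" "?K \<subseteq> Iso_simple C" using F G by auto
    have KF: "\<forall>X\<in>Iso_simple C - ?K. \<xi> X = (\<lambda>x. 0)" "\<forall>X\<in>Iso_simple C - ?K. \<zeta> X = (\<lambda>x. 0)"
      using F(3) G(3) by auto
    have c: "\<xi> X \<in> carrier (Hdual scale)" "\<zeta> X \<in> carrier (Hdual scale)" if "X \<in> ?K" for X
    proof -
      have "X \<in> Iso_simple C" using K(2) that by blast
      then show "\<xi> X \<in> carrier (Hdual scale)" "\<zeta> X \<in> carrier (Hdual scale)"
        by (rule Hdual_simple_sumD(3)[OF \<xi>], rule Hdual_simple_sumD(3)[OF \<zeta>])
    qed
    have "?n (\<lambda>X\<in>Iso_simple C. \<lambda>x. \<xi> X x + \<zeta> X x) =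
        (\<lambda>x. \<Sum>X\<in>?K. (\<lambda>X\<in>Iso_simple C. \<lambda>x. \<xi> X x + \<zeta> X x) X x)"
    proof (rule natural_map_eq[OF K])
      show "\<forall>X\<in>Iso_simple C - ?K. (\<lambda>X\<in>Iso_simple C. \<lambda>x. \<xi> X x + \<zeta> X x) X = (\<lambda>x. 0)"
        using KF by simp
      show "(\<lambda>X\<in>Iso_simple C. \<lambda>x. \<xi> X x + \<zeta> X x) X \<in> carrier (Hdual scale)" if "X \<in> ?K" for X
        using c[OF that] K(2) that by (auto simp: Hdual_carrier_iff algebra_simps)
    qed
    also have "\<dots> = (\<lambda>x. \<Sum>X\<in>?K. \<xi> X x + \<zeta> X x)"
    proof
      show "(\<Sum>X\<in>?K. (\<lambda>X\<in>Iso_simple C. \<lambda>x. \<xi> X x + \<zeta> X x) X x) = (\<Sum>X\<in>?K. \<xi> X x + \<zeta> X x)" for x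
        by (rule sum.cong) (use K(2) in auto)
    qed
    also have "\<dots> = (\<lambda>x. ?n \<xi> x + ?n \<zeta> x)"
      using natural_map_eq[OF K KF(1) c(1)] natural_map_eq[OF K KF(2) c(2)] by (simp add: sum.distrib)
    finally show ?thesis .
  qed
  have r: "(\<lambda>x. \<eta> (x * h)) \<in> carrier (Hdual scale)" "(\<lambda>x. \<eta> (h * x)) \<in> carrier (Hdual scale)"
    if "\<eta> \<in> carrier (Hdual scale)" for \<eta> h
    using that by (simp_all add: Hdual_carrier_iff distrib_left distrib_right scale_mult_left scale_mult_right)
  have "?n \<in> lhom ?S ?T"
  proof (rule lhomI)
    show "?n (h \<triangleright>\<^bsub>?S\<^esub> \<xi>) = h \<triangleright>\<^bsub>?T\<^esub> ?n \<xi>" if "\<xi> \<in> carrier ?S" for \<xi> h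
      using linear[of \<xi> "\<lambda>x. x * h", OF that r(1)] by simp
  qed (simp_all add: natural_map_in_Hdual_sum add)
  moreover have "?n (bract ?S \<xi> h) = bract ?T (?n \<xi>) h" if "\<xi> \<in> carrier ?S" for \<xi> h
    using linear[of \<xi> "\<lambda>x. h * x", OF that r(2)] by simp
  moreover have "bij_betw ?n (carrier ?S) (carrier ?T)"
  proof (rule bij_betw_imageI[OF natural_map_inj])
    show "?n ` carrier ?S = carrier ?T"
    proof
      show "?n ` carrier ?S \<subseteq> carrier ?T" using natural_map_in_Hdual_sum by blast
      show "carrier ?T \<subseteq> ?n ` carrier ?S"
        using natural_map_onto_coeffs Hdual_sum_subset_coeffs assms by blast
    qed
  qed
  ultimately show ?thesis by (simp add: bimodule_iso_def)
qed

text \<open>A coefficient of \<open>v\<close> is the sum of the coefficients of its components in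
  the simple summands. The direct sum has another carrier type and is not itself an object, so
  transposes are taken along the composites \<open>M i \<rightarrow> V\<close>, which are morphisms
  between objects.\<close>

lemma semisimple_coeffs_subset:
  assumes "semisimple_category C" shows "coeffs St C \<subseteq> coeffs St (simple_objects C)"
proof
  have simple_C: "simple_objects C \<subseteq> C" by (auto simp: simple_objects_def)
  have single: "(\<lambda>h. f (h \<triangleright>\<^bsub>V\<^esub> v)) \<in> coeffs St (simple_objects C)"
    if V: "V \<in> C" and v: "v \<in> carrier V" and f: "f \<in> St V" for V v f
  proof -
    interpret V: left_module V by (rule module[OF V])
    obtain n :: nat and M where M: "\<forall>i<n. M i \<in> simple_objects C"
      and iso: "lisomorphic V (ldirect_sum {..<n} M)"
      using assms V unfolding semisimple_category_def by blast
    let ?D = "ldirect_sum {..<n} M"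
    have MC: "M i \<in> C" if "i < n" for i using M that simple_C by blast
    have Mmod: "left_module (M i)" if "i \<in> {..<n}" for i using module MC that by simp
    have D: "carrier ?D = (\<Pi>\<^sub>E i\<in>{..<n}. carrier (M i))"
      "x \<otimes>\<^bsub>?D\<^esub> y = (\<lambda>i\<in>{..<n}. x i \<otimes>\<^bsub>M i\<^esub> y i)"
      "h \<triangleright>\<^bsub>?D\<^esub> x = (\<lambda>i\<in>{..<n}. h \<triangleright>\<^bsub>M i\<^esub> x i)" for x y h
      by (rule ldirect_sum_carrier ldirect_sum_mult ldirect_sum_lact, erule Mmod | rule finite_lessThan)+
    from iso obtain \<phi> where \<phi>: "\<phi> \<in> lhom V ?D" and bij: "bij_betw \<phi> (carrier V) (carrier ?D)"
      by (rule lisomorphicE)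
    let ?\<psi> = "inv_into (carrier V) \<phi>"
    have \<psi>: "?\<psi> \<in> lhom ?D V" by (rule inv_into_lhom[OF V.left_module_axioms \<phi> bij])
    define emb where "emb i m = (\<lambda>j\<in>{..<n}. if j = i then m else \<one>\<^bsub>M j\<^esub>)" for i and m :: 'v
    have emb: "emb i \<in> lhom (M i) ?D" if i: "i < n" for i
    proof (rule lhomI)
      show "emb i m \<in> carrier ?D" if "m \<in> carrier (M i)" for m
        unfolding D(1) emb_def
        using that Mmod by (auto simp: left_module_def comm_group_def group_def monoid.one_closed)
      show "emb i (m \<otimes>\<^bsub>M i\<^esub> m') = emb i m \<otimes>\<^bsub>?D\<^esub> emb i m'"
        if "m \<in> carrier (M i)" "m' \<in> carrier (M i)" for m m'
        unfolding D(2) emb_def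
        using that Mmod
        by (auto simp: fun_eq_iff left_module_def comm_group_def group_def monoid.l_one monoid.one_closed)
      show "emb i (h \<triangleright>\<^bsub>M i\<^esub> m) = h \<triangleright>\<^bsub>?D\<^esub> emb i m" if "m \<in> carrier (M i)" for h m
        unfolding D(3) emb_def using Mmod by (auto simp: fun_eq_iff left_module.lact_unit)
    qed
    have summand: "(\<lambda>h. f (h \<triangleright>\<^bsub>V\<^esub> ?\<psi> (emb i m))) \<in> coeffs St (simple_objects C)"
      if "i < n" "m \<in> carrier (M i)" for i m
    proof -
      have "(\<lambda>h. f (h \<triangleright>\<^bsub>V\<^esub> (?\<psi> \<circ> emb i) m)) \<in> coeffs St (simple_objects C)"
        by (rule coefficient_transpose[of "M i" _ V "?\<psi> \<circ> emb i"])
          (use M that simple_C V f lhom_comp[OF emb \<psi>] in auto)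
      then show ?thesis by simp
    qed
    let ?x = "\<phi> v"
    have x: "?x \<in> (\<Pi>\<^sub>E i\<in>{..<n}. carrier (M i))" using lhomD(1)[OF \<phi> v] D(1) by simp
    have xi: "?x i \<in> carrier (M i)" if "i < n" for i using PiE_mem[OF x, of i] that by simp
    \<comment> \<open>\<open>part k\<close> keeps the components below \<open>k\<close>, so
      \<open>v\<close> is assembled by adding one summand at a time.\<close>
    define part where "part k = (\<lambda>j\<in>{..<n}. if j < k then ?x j else \<one>\<^bsub>M j\<^esub>)" for k
    have part: "part k \<in> carrier ?D" for k
      unfolding D(1) part_def using xi Mmod
      by (auto simp: left_module_def comm_group_def group_def monoid.one_closed)
    have "(\<lambda>h. f (h \<triangleright>\<^bsub>V\<^esub> ?\<psi> (part k))) \<in> coeffs St (simple_objects C)" if "k \<le> n" for k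
      using that
    proof (induction k)
      case 0
      \<comment> \<open>An element \<open>e\<close> of the group \<open>V\<close> with
        \<open>e + e = e\<close> is zero; this sends \<open>part 0\<close> to zero without a module
        structure on the direct sum.\<close>
      have "part 0 \<otimes>\<^bsub>?D\<^esub> part 0 = part 0"
        unfolding D(2) part_def using Mmod
        by (auto simp: fun_eq_iff left_module_def comm_group_def group_def monoid.l_one monoid.one_closed)
      then have "?\<psi> (part 0) \<otimes>\<^bsub>V\<^esub> ?\<psi> (part 0) = ?\<psi> (part 0)"
        using lhomD(2)[OF \<psi> part part, of 0 0] by simp
      then have "?\<psi> (part 0) = \<one>\<^bsub>V\<^esub>"
        using V.l_cancel_one[of "?\<psi> (part 0)" "?\<psi> (part 0)"] lhomD(1)[OF \<psi> part] by simp
      then show ?case using functional_one[OF V f] by (simp add: coeffs_zero)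
    next
      case (Suc k)
      have k: "k < n" using Suc.prems by simp
      have "part (Suc k) = part k \<otimes>\<^bsub>?D\<^esub> emb k (?x k)"
        unfolding D(2) part_def emb_def using Mmod xi
        by (auto simp: fun_eq_iff left_module_def comm_group_def group_def monoid.l_one monoid.r_one
            monoid.one_closed less_Suc_eq)
      then have "?\<psi> (part (Suc k)) = ?\<psi> (part k) \<otimes>\<^bsub>V\<^esub> ?\<psi> (emb k (?x k))"
        using lhomD(2)[OF \<psi> part lhomD(1)[OF emb[OF k] xi[OF k]]] by simp
      moreover have "?\<psi> (part k) \<in> carrier V" "?\<psi> (emb k (?x k)) \<in> carrier V"
        by (rule lhomD(1)[OF \<psi> part], rule lhomD(1)[OF \<psi> lhomD(1)[OF emb[OF k] xi[OF k]]])
      ultimately have "f (h \<triangleright>\<^bsub>V\<^esub> ?\<psi> (part (Suc k))) =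
          f (h \<triangleright>\<^bsub>V\<^esub> ?\<psi> (part k)) + f (h \<triangleright>\<^bsub>V\<^esub> ?\<psi> (emb k (?x k)))" for h
        by (simp add: V.lact_add_right functional_add[OF V f] V.lact_closed)
      then show ?case using coeffs_add[OF Suc.IH summand[OF k xi[OF k]]] k by simp
    qed
    moreover have "part n = ?x"
      by (rule PiE_ext[OF part[unfolded D(1)] x]) (simp add: part_def)
    moreover have "?\<psi> ?x = v" using bij v by (simp add: bij_betw_def)
    ultimately show ?thesis by (metis order_refl)
  qed
  fix \<xi> assume "\<xi> \<in> coeffs St C"
  then show "\<xi> \<in> coeffs St (simple_objects C)"
    by (induction rule: coeffs_induct) (use coeffs_zero coeffs_add[OF single] in blast)+
qed

text \<open>If \<open>f s \<noteq> 0\<close> for some \<open>s\<close> in a simple submodule \<open>S\<close>, then \<open>v \<mapsto> \<beta>\<^sub>V (v \<otimes> f)\<close> is injective on \<open>S\<close>;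
  as its image lies in the socle of \<open>H\<^sup>*\<close>, the preimage of a complement of the image of \<open>S\<close> is
  a complement of \<open>S\<close>.\<close>

lemma simple_submodule_complement:
  assumes incl: "coeffs St C \<subseteq> coeffs St (simple_objects C)"
    and V: "V \<in> C" and S: "lsubmodule S V" and simple: "simple_lmodule (V\<lparr>carrier := S\<rparr>)"
  shows "\<exists>W. lsubmodule W V \<and> W \<inter> S = {\<one>\<^bsub>V\<^esub>} \<and> carrier V \<subseteq> W <#>\<^bsub>V\<^esub> S"
proof -
  interpret V: left_module V by (rule module[OF V])
  interpret H: left_module "Hdual scale" by (rule left_module_Hdual)
  have "S \<noteq> {\<one>\<^bsub>V\<^esub>}" using simple by (simp add: simple_lmodule_def)
  then obtain s where s: "s \<in> S" "s \<noteq> \<one>\<^bsub>V\<^esub>" using lsubmoduleD(3)[OF S] by blast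
  then have sV: "s \<in> carrier V" using lsubmoduleD(2)[OF S] by blast
  obtain f where f: "f \<in> St V" "f s \<noteq> 0" using functionals_separate[OF V sV s(2)] .
  define \<phi> where "\<phi> = (\<lambda>v h. f (h \<triangleright>\<^bsub>V\<^esub> v))"
  interpret \<phi>: lmodule_hom V "Hdual scale" \<phi>
    unfolding \<phi>_def by (rule lmodule_hom_coefficient[OF V f(1)])
  \<comment> \<open>Evaluation of a coefficient at 1 recovers the functional.\<close>
  have "\<phi> s 1 \<noteq> 0" using f(2) sV by (simp add: \<phi>_def V.lact_one)
  then have \<phi>s: "\<phi> s \<noteq> \<one>\<^bsub>Hdual scale\<^esub>" by auto
  \<comment> \<open>\<open>inj_on_simple\<close> asks for a simple source, hence the restriction of
    \<open>\<phi>\<close> to \<open>S\<close>.\<close>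
  interpret \<phi>S: lmodule_hom "V\<lparr>carrier := S\<rparr>" "Hdual scale" \<phi>
    using \<phi>.map lsubmoduleD(2)[OF S]
    by (intro lmodule_hom.intro lmodule_hom_axioms.intro V.left_module_restrict[OF S]
        left_module_Hdual lhomI) (simp_all add: subset_iff)
  have inj: "inj_on \<phi> S" using \<phi>S.inj_on_simple[OF simple, of s] s(1) \<phi>s by simp
  have image_S: "lsubmodule (\<phi> ` S) (Hdual scale)" by (rule \<phi>.lsubmodule_image[OF S])
  obtain N where N: "lsubmodule N (Hdual scale)" "N \<inter> \<phi> ` S = {\<one>\<^bsub>Hdual scale\<^esub>}"
    and socle: "\<And>T. lsubmodule T (Hdual scale) \<Longrightarrow>
      (\<And>X. lsubmodule X (Hdual scale) \<Longrightarrow> X \<subseteq> T \<Longrightarrow> X = {\<one>\<^bsub>Hdual scale\<^esub>} \<or> X = T) \<Longrightarrow>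
      T \<subseteq> N <#>\<^bsub>Hdual scale\<^esub> \<phi> ` S"
    using H.complement_in_socle[OF image_S] by blast
  let ?N = "N <#>\<^bsub>Hdual scale\<^esub> \<phi> ` S"
  have sub: "lsubmodule ?N (Hdual scale)" by (rule H.lsubmodule_set_mult[OF N(1) image_S])
  have coeffs_le: "\<xi> \<in> ?N" if "\<xi> \<in> coeffs St (simple_objects C)" for \<xi>
    using that
  proof (induction rule: coeffs_induct)
    case zero
    then show ?case using lsubmoduleD(3)[OF sub] by simp
  next
    case (add U u g \<zeta>)
    then have U: "U \<in> C" and simple_U: "simple_lmodule U" by (auto simp: simple_objects_def)
    interpret g: lmodule_hom U "Hdual scale" "\<lambda>v h. g (h \<triangleright>\<^bsub>U\<^esub> v)"
      by (rule lmodule_hom_coefficient[OF U add(3)])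
    \<comment> \<open>The image of the simple \<open>U\<close> has no submodules besides zero and
      itself, so \<open>socle\<close> applies even if the image is zero.\<close>
    have "(\<lambda>v h. g (h \<triangleright>\<^bsub>U\<^esub> v)) ` carrier U \<subseteq> ?N"
      by (rule socle) (rule g.lsubmodule_image[OF g.V.lsubmodule_carrier], rule g.image_of_simple[OF simple_U])
    then have "(\<lambda>h. g (h \<triangleright>\<^bsub>U\<^esub> u)) \<in> ?N" using add(2) by blast
    then show ?case using lsubmoduleD(4)[OF sub _ add(4)] by simp
  qed
  let ?W = "{v \<in> carrier V. \<phi> v \<in> N}"
  have "lsubmodule ?W V" by (rule \<phi>.lsubmodule_vimage[OF N(1)])
  moreover have "?W \<inter> S = {\<one>\<^bsub>V\<^esub>}"
  proof
    show "{\<one>\<^bsub>V\<^esub>} \<subseteq> ?W \<inter> S"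
      using lsubmoduleD(3)[OF S] lsubmoduleD(3)[OF \<open>lsubmodule ?W V\<close>] by simp
    show "?W \<inter> S \<subseteq> {\<one>\<^bsub>V\<^esub>}"
    proof
      fix v assume v: "v \<in> ?W \<inter> S"
      then have "\<phi> v \<in> N \<inter> \<phi> ` S" by simp
      then have "\<phi> v = \<phi> \<one>\<^bsub>V\<^esub>" unfolding N(2) by simp
      then show "v \<in> {\<one>\<^bsub>V\<^esub>}" using inj_onD[OF inj] v lsubmoduleD(3)[OF S] by blast
    qed
  qed
  moreover have "carrier V \<subseteq> ?W <#>\<^bsub>V\<^esub> S"
  proof
    fix v assume v: "v \<in> carrier V"
    have "\<phi> v \<in> coeffs St C" unfolding \<phi>_def by (rule coeffs_single[of V C v f St, OF V v f(1)])
    then have "\<phi> v \<in> ?N" using incl coeffs_le by blast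
    then obtain n t where n: "n \<in> N" "t \<in> S" "\<phi> v = n \<otimes>\<^bsub>Hdual scale\<^esub> \<phi> t"
      by (elim H.set_multE imageE) simp
    have t: "t \<in> carrier V" using n(2) lsubmoduleD(2)[OF S] by blast
    have nH: "n \<in> carrier (Hdual scale)" using n(1) lsubmoduleD(2)[OF N(1)] by blast
    \<comment> \<open>With \<open>\<phi> v = n + \<phi> t\<close>, the part of \<open>v\<close> in
      the preimage of \<open>N\<close> is \<open>v - t\<close>. The rules \<open>Hdual_simps\<close>
      are removed to keep the terms in group notation.\<close>
    have "\<phi> (v \<otimes>\<^bsub>V\<^esub> inv\<^bsub>V\<^esub> t) = n"
      using n(3) nH \<phi>.map(1)[OF t] v t by (simp add: \<phi>.map(2) \<phi>.map_inv H.m_assoc del: Hdual_simps)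
    then have "v \<otimes>\<^bsub>V\<^esub> inv\<^bsub>V\<^esub> t \<in> ?W" using n(1) v t by simp
    from V.set_multI[OF this n(2)] show "v \<in> ?W <#>\<^bsub>V\<^esub> S"
      using v t by (simp add: V.m_assoc)
  qed
  ultimately show ?thesis by blast
qed

end

theorem theorem1p2:
  fixes scale :: "'k::field \<Rightarrow> 'h::{ring, monoid_mult} \<Rightarrow> 'h"
    and C :: "('h, 'v) lmodule set"
    and St :: "('h, 'v) lmodule \<Rightarrow> ('v \<Rightarrow> 'k) set"
  assumes "assoc_algebra scale"
    and "full_abelian_subcategory C"
    and "closed_under_submodules C"
    and "finite_duality_functor scale C St"
    and "\<forall>V\<in>C. finite_length V"
  shows "(natural_map scale C \<in> bimodule_iso (Hdual_simple_sum scale C St) (Hdual_sum scale C St)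
            \<longrightarrow> semisimple_category C) \<and>
         (semisimple_category C \<and>
            (\<forall>V\<in>simple_objects C. simple_bimodule (tensor scale V (St V)))
            \<longrightarrow> natural_map scale C \<in>
                  bimodule_iso (Hdual_simple_sum scale C St) (Hdual_sum scale C St))"
proof -
  have module: "left_module V" if "V \<in> C" for V
    using assms(2) that by (simp add: full_abelian_subcategory_def)
  interpret dual_category scale C St
    using assms(1,4) module by (intro dual_category.intro dual_category_axioms.intro)
  show ?thesis
  proof (intro conjI impI)
    assume iso: "natural_map scale C \<in> bimodule_iso (Hdual_simple_sum scale C St) (Hdual_sum scale C St)"
    have onto: "carrier (Hdual_sum scale C St) = natural_map scale C ` carrier (Hdual_simple_sum scale C St)"
      using iso by (simp add: bimodule_iso_def bij_betw_def)
    \<comment> \<open>The coefficient lies in \<open>Hdual_sum\<close>, hence by surjectivity in the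
      image of the natural map, which consists of sums of coefficients of simple objects.\<close>
    have single: "(\<lambda>h. f (h \<triangleright>\<^bsub>V\<^esub> v)) \<in> coeffs St (simple_objects C)"
      if "V \<in> C" "v \<in> carrier V" "f \<in> St V" for V v f
    proof -
      have "(\<lambda>h. f (h \<triangleright>\<^bsub>V\<^esub> v)) \<in> carrier (Hdual_sum scale C St)"
        by (rule coefficient_in_Hdual_sum[OF that])
      then show ?thesis unfolding onto by (elim imageE) (simp only: natural_map_in_coeffs)
    qed
    have "coeffs St C \<subseteq> coeffs St (simple_objects C)"
    proof
      show "\<xi> \<in> coeffs St (simple_objects C)" if "\<xi> \<in> coeffs St C" for \<xi>
        using that by (induction rule: coeffs_induct) (use coeffs_zero coeffs_add[OF single] in blast)+
    qed
    then show "semisimple_category C"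
      using assms(5) by (intro semisimple_category_if_complements module assms(3)
          simple_submodule_complement) auto
  next
    assume "semisimple_category C \<and> (\<forall>V\<in>simple_objects C. simple_bimodule (tensor scale V (St V)))"
    then show "natural_map scale C \<in>
        bimodule_iso (Hdual_simple_sum scale C St) (Hdual_sum scale C St)"
      by (intro natural_map_bimodule_iso semisimple_coeffs_subset) simp
  qed
qed

end
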